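(* The element $\pi(\boldsymbol{p})=(\pi(p)\bmod p)_p$ of the ring $\mathcal{A}$ does not belong to $\mathcal{C}_{\mathcal{A}}$, the integral closure of $\mathbb{Q}$ in $\mathcal{A}$; that is, $\pi(\boldsymbol{p})\notin\mathcal{C}_{\mathcal{A}}$.
   Context: Let $\mathcal{A}$ be the quotient ring $$\mathcal{A}=\Biggl(\prod_{p\text{ prime}}\mathbb{Z}/p\mathbb{Z}\Biggr)\Bigg/\Biggl(\bigoplus_{p\text{ prime}}\mathbb{Z}/p\mathbb{Z}\Biggr),$$ where both the product and the direct sum run over all primes $p$. An element of $\mathcal{A}$ is written $(a_p \bmod p)_p$; two such families represent the same element if and only if they agree for all but finitely many primes $p$. The ring $\mathcal{A}$ is a $\mathbb{Q}$-algebra, where $\mathbb{Q}$ is embedded in $\mathcal{A}$ by sending $r\in\mathbb{Q}$ to the class of $(r\bmod p)_p$ (with arbitrary components at the finitely many primes dividing the denominator of $r$). $\mathcal{C}_{\mathcal{A}}$ denotes the integral closure of $\mathbb{Q}$ in $\mathcal{A}$, i.e. the set of elements of $\mathcal{A}$ that are roots of some monic polynomial with coefficients in $\mathbb{Q}$. An element of $\mathcal{A}$ is called transcendental in the strong sense if it does not belong to $\mathcal{C}_{\mathcal{A}}$. The function $\pi(X)$ is the prime-counting function (the number of primes at most $X$), and $\pi(\boldsymbol{p})$ denotes the element $(\pi(p)\bmod p)_p\in\mathcal{A}$; equivalently, its component at the $n$th prime $p_n$ is $n\bmod p_n$. *)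

theory Defs
  imports "HOL-Algebra.Polynomials" "HOL-Algebra.QuotRing" "HOL-Number_Theory.Number_Theory"
begin

section \<open>Products of rings\<close>

definition product_ring :: "'i set \<Rightarrow> ('i \<Rightarrow> 'a ring) \<Rightarrow> ('i \<Rightarrow> 'a) ring" where
  "product_ring I R =
     \<lparr>carrier = (\<Pi>\<^sub>E i\<in>I. carrier (R i)),
      mult = (\<lambda>x y. \<lambda>i\<in>I. x i \<otimes>\<^bsub>R i\<^esub> y i),
      one = (\<lambda>i\<in>I. \<one>\<^bsub>R i\<^esub>),
      zero = (\<lambda>i\<in>I. \<zero>\<^bsub>R i\<^esub>),
      add = (\<lambda>x y. \<lambda>i\<in>I. x i \<oplus>\<^bsub>R i\<^esub> y i)\<rparr>"

definition direct_sum :: "'i set \<Rightarrow> ('i \<Rightarrow> 'a ring) \<Rightarrow> ('i \<Rightarrow> 'a) set" where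
  "direct_sum I R = {x \<in> carrier (product_ring I R). finite {i \<in> I. x i \<noteq> \<zero>\<^bsub>R i\<^esub>}}"

lemma product_ring_cring:
  assumes "\<And>i. i \<in> I \<Longrightarrow> cring (R i)"
  shows "cring (product_ring I R)"
proof -
  note ax = assms[THEN cring.axioms(1)]
  have ab: "\<And>i. i \<in> I \<Longrightarrow> abelian_group (R i)"
    using ax ring.is_abelian_group by blast
  show ?thesis
  proof (rule cringI)
    show "abelian_group (product_ring I R)"
    proof (rule abelian_groupI)
      fix x assume x: "x \<in> carrier (product_ring I R)"
      define y where "y = (\<lambda>i\<in>I. \<ominus>\<^bsub>R i\<^esub> x i)"
      have "y \<in> carrier (product_ring I R)"
        using x ab by (auto simp: product_ring_def y_def PiE_iff intro!: abelian_group.a_inv_closed)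
      moreover have "y \<oplus>\<^bsub>product_ring I R\<^esub> x = \<zero>\<^bsub>product_ring I R\<^esub>"
        using x ab by (auto simp: product_ring_def y_def PiE_iff abelian_group.l_neg intro!: restrict_ext)
      ultimately show "\<exists>y\<in>carrier (product_ring I R). y \<oplus>\<^bsub>product_ring I R\<^esub> x = \<zero>\<^bsub>product_ring I R\<^esub>"
        by blast
    qed (use assms in \<open>auto simp: product_ring_def PiE_iff extensional_def fun_eq_iff
            cring.cring_simprules\<close>)
    show "comm_monoid (product_ring I R)"
      by (rule comm_monoidI)
         (use assms in \<open>auto simp: product_ring_def PiE_iff extensional_def fun_eq_iff
            cring.cring_simprules comm_monoid.m_comm monoid.r_one cring_def ring_def
            monoid.l_one monoid.m_assoc monoid.m_closed monoid.one_closed\<close>)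
    fix x y z assume "x \<in> carrier (product_ring I R)" "y \<in> carrier (product_ring I R)"
      "z \<in> carrier (product_ring I R)"
    then show "(x \<oplus>\<^bsub>product_ring I R\<^esub> y) \<otimes>\<^bsub>product_ring I R\<^esub> z =
        x \<otimes>\<^bsub>product_ring I R\<^esub> z \<oplus>\<^bsub>product_ring I R\<^esub> y \<otimes>\<^bsub>product_ring I R\<^esub> z"
      using ax by (auto simp: product_ring_def PiE_iff extensional_def fun_eq_iff ring.ring_simprules)
  qed
qed

lemma ideal_direct_sum:
  assumes R: "\<And>i. i \<in> I \<Longrightarrow> cring (R i)"
  shows "ideal (direct_sum I R) (product_ring I R)"
proof -
  let ?P = "product_ring I R"
  interpret P: cring ?P by (rule product_ring_cring) (rule R)
  have ax: "\<And>i. i \<in> I \<Longrightarrow> ring (R i)"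
    using R cring.axioms(1) by blast
  have inv: "(\<ominus>\<^bsub>?P\<^esub> x) i = \<ominus>\<^bsub>R i\<^esub> x i" if "x \<in> carrier ?P" "i \<in> I" for x i
  proof -
    interpret Ri: cring "R i" using R that by blast
    have c: "\<ominus>\<^bsub>?P\<^esub> x \<in> carrier ?P" using that by simp
    have "(\<ominus>\<^bsub>?P\<^esub> x \<oplus>\<^bsub>?P\<^esub> x) i = \<zero>\<^bsub>?P\<^esub> i" using that by (simp add: P.l_neg)
    then have "(\<ominus>\<^bsub>?P\<^esub> x) i \<oplus>\<^bsub>R i\<^esub> x i = \<zero>\<^bsub>R i\<^esub>"
      using that by (simp add: product_ring_def)
    moreover have "(\<ominus>\<^bsub>?P\<^esub> x) i \<in> carrier (R i)" "x i \<in> carrier (R i)"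
      using c that by (auto simp: product_ring_def)
    ultimately show ?thesis using Ri.minus_equality by metis
  qed
  show ?thesis
  proof (rule idealI)
    show "ring ?P" by (rule P.ring_axioms)
    show "subgroup (direct_sum I R) (add_monoid ?P)"
    proof (rule group.subgroupI)
      show "group (add_monoid ?P)" by (rule P.add.group_axioms)
      show "direct_sum I R \<subseteq> carrier (add_monoid ?P)" by (auto simp: direct_sum_def)
      have z: "{i \<in> I. \<zero>\<^bsub>?P\<^esub> i \<noteq> \<zero>\<^bsub>R i\<^esub>} = {}" by (auto simp: product_ring_def)
      have "\<zero>\<^bsub>?P\<^esub> \<in> direct_sum I R"
        unfolding direct_sum_def using P.zero_closed by (simp only: mem_Collect_eq z) simp
      then show "direct_sum I R \<noteq> {}" by auto
    next
      fix a assume a: "a \<in> direct_sum I R"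
      then have ac: "a \<in> carrier ?P" and af: "finite {i \<in> I. a i \<noteq> \<zero>\<^bsub>R i\<^esub>}"
        by (auto simp: direct_sum_def)
      have "{i \<in> I. (\<ominus>\<^bsub>?P\<^esub> a) i \<noteq> \<zero>\<^bsub>R i\<^esub>} \<subseteq> {i \<in> I. a i \<noteq> \<zero>\<^bsub>R i\<^esub>}"
      proof
        fix i assume i: "i \<in> {i \<in> I. (\<ominus>\<^bsub>?P\<^esub> a) i \<noteq> \<zero>\<^bsub>R i\<^esub>}"
        then interpret Ri: cring "R i" using R by blast
        show "i \<in> {i \<in> I. a i \<noteq> \<zero>\<^bsub>R i\<^esub>}" using i inv[OF ac] by auto
      qed
      then have "\<ominus>\<^bsub>?P\<^esub> a \<in> direct_sum I R"
        using ac af by (auto simp: direct_sum_def intro: finite_subset)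
      then show "inv\<^bsub>add_monoid ?P\<^esub> a \<in> direct_sum I R" by (simp add: a_inv_def)
    next
      fix a b assume a: "a \<in> direct_sum I R" and b: "b \<in> direct_sum I R"
      have "{i \<in> I. (a \<oplus>\<^bsub>?P\<^esub> b) i \<noteq> \<zero>\<^bsub>R i\<^esub>} \<subseteq>
          {i \<in> I. a i \<noteq> \<zero>\<^bsub>R i\<^esub>} \<union> {i \<in> I. b i \<noteq> \<zero>\<^bsub>R i\<^esub>}"
        using ax by (auto simp: product_ring_def ring.ring_simprules)
      then have "a \<oplus>\<^bsub>?P\<^esub> b \<in> direct_sum I R"
        using a b P.a_closed by (auto simp: direct_sum_def intro: finite_subset)
      then show "a \<otimes>\<^bsub>add_monoid ?P\<^esub> b \<in> direct_sum I R" by simp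
    qed
    fix a x assume a: "a \<in> direct_sum I R" and x: "x \<in> carrier ?P"
    have "{i \<in> I. (x \<otimes>\<^bsub>?P\<^esub> a) i \<noteq> \<zero>\<^bsub>R i\<^esub>} \<subseteq> {i \<in> I. a i \<noteq> \<zero>\<^bsub>R i\<^esub>}"
      using ax x by (auto simp: product_ring_def PiE_iff ring.ring_simprules)
    then show xa: "x \<otimes>\<^bsub>?P\<^esub> a \<in> direct_sum I R"
      using a x P.m_closed by (auto simp: direct_sum_def intro: finite_subset)
    then show "a \<otimes>\<^bsub>?P\<^esub> x \<in> direct_sum I R"
      using P.m_comm[of a x] a x by (simp add: direct_sum_def)
  qed
qed


section \<open>The ring of families modulo almost all primes\<close>

abbreviation primes :: "nat set" where
  "primes \<equiv> {p. Factorial_Ring.prime p}"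

definition residues_product :: "(nat \<Rightarrow> int) ring" where
  "residues_product = product_ring primes (\<lambda>p. residue_ring (int p))"

definition residues_sum :: "(nat \<Rightarrow> int) set" where
  "residues_sum = direct_sum primes (\<lambda>p. residue_ring (int p))"

definition ring_A :: "(nat \<Rightarrow> int) set ring" where
  "ring_A = residues_product Quot residues_sum"

text \<open>The class of \<open>(a\<^sub>p mod p)\<^sub>p\<close>.\<close>
definition class_A :: "(nat \<Rightarrow> int) \<Rightarrow> (nat \<Rightarrow> int) set" where
  "class_A a = residues_sum +>\<^bsub>residues_product\<^esub> (\<lambda>p\<in>primes. a p mod int p)"

text \<open>
  If \<open>r = a / b\<close> in lowest terms, the component at \<open>p\<close> is \<open>a * b\<^sup>-\<^sup>1 mod p\<close>; it is \<open>0\<close> at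
  the finitely many primes dividing \<open>b\<close>, where \<^const>\<open>modular_inverse\<close> is \<open>0\<close> by convention.
\<close>
definition rat_A :: "rat \<Rightarrow> (nat \<Rightarrow> int) set" where
  "rat_A r = (case quotient_of r of (a, b) \<Rightarrow> class_A (\<lambda>p. a * modular_inverse (int p) b))"

text \<open>
  Elements of \<^term>\<open>univ_poly R K\<close> are coefficient lists over \<open>K\<close> with the leading
  coefficient first; \<open>[]\<close> is the zero polynomial, for which \<open>lead_coeff\<close> is unspecified.
\<close>
definition integral_closure :: "('a, 'b) ring_scheme \<Rightarrow> 'a set \<Rightarrow> 'a set" where
  "integral_closure R K =
     {x \<in> carrier R. \<exists>f \<in> carrier (univ_poly R K).
        f \<noteq> [] \<and> lead_coeff f = \<one>\<^bsub>R\<^esub> \<and> ring.eval R f x = \<zero>\<^bsub>R\<^esub>}"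

definition C_A :: "(nat \<Rightarrow> int) set set" where
  "C_A = integral_closure ring_A (range rat_A)"

definition prime_counting :: "nat \<Rightarrow> nat" where
  "prime_counting n = card {q \<in> primes. q \<le> n}"

definition pi_A :: "(nat \<Rightarrow> int) set" where
  "pi_A = class_A (\<lambda>p. int (prime_counting p))"


section \<open>Elementary facts on the ring and its rational elements\<close>

lemma residue_ring_prime_cring: "p \<in> primes \<Longrightarrow> cring (residue_ring (int p))"
  using prime_gt_1_nat by (intro residues.cring residues.intro) auto

lemma residues_sum_ideal: "ideal residues_sum residues_product"
  unfolding residues_sum_def residues_product_def
  by (rule ideal_direct_sum) (rule residue_ring_prime_cring)

lemma residues_product_cring: "cring residues_product"
  unfolding residues_product_def by (rule product_ring_cring) (rule residue_ring_prime_cring)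

lemma ring_A_cring: "cring ring_A"
  unfolding ring_A_def
  by (rule ideal.quotient_is_cring[OF residues_sum_ideal residues_product_cring])

lemma reduce_closed: "(\<lambda>p\<in>primes. a p mod int p) \<in> carrier residues_product"
  using prime_gt_0_nat
  by (auto simp: residues_product_def product_ring_def residue_ring_def PiE_iff)

lemma class_A_closed: "class_A a \<in> carrier ring_A"
proof -
  interpret I: ideal residues_sum residues_product by (rule residues_sum_ideal)
  show ?thesis
    unfolding class_A_def ring_A_def FactRing_def
    by (simp add: I.a_rcosetsI[OF I.a_subset] reduce_closed)
qed

lemma carrier_ring_A: "carrier ring_A = range class_A"
proof
  show "carrier ring_A \<subseteq> range class_A"
  proof
    fix Y assume "Y \<in> carrier ring_A"
    then obtain a where a: "a \<in> carrier residues_product" "Y = residues_sum +>\<^bsub>residues_product\<^esub> a"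
      by (auto simp: ring_A_def FactRing_def A_RCOSETS_def RCOSETS_def a_r_coset_def)
    have "(\<lambda>p\<in>primes. a p mod int p) = a"
      using a(1) by (auto simp: residues_product_def product_ring_def residue_ring_def
          PiE_iff extensional_def fun_eq_iff)
    then show "Y \<in> range class_A" using a(2) by (metis class_A_def rangeI)
  qed
qed (use class_A_closed in auto)

lemma class_A_eq_iff: "class_A a = class_A b \<longleftrightarrow> finite {p \<in> primes. [a p \<noteq> b p] (mod int p)}"
proof -
  let ?P = residues_product
  interpret I: ideal residues_sum ?P by (rule residues_sum_ideal)
  let ?r = "\<lambda>a. \<lambda>p\<in>primes. a p mod int p"
  define d where "d = (\<lambda>p\<in>primes. (a p - b p) mod int p)"
  have d: "d \<in> carrier ?P" unfolding d_def by (rule reduce_closed)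
  have sum: "d \<oplus>\<^bsub>?P\<^esub> ?r b = ?r a"
    by (auto simp: d_def residues_product_def product_ring_def residue_ring_def mod_simps fun_eq_iff)
  have minus: "?r a \<ominus>\<^bsub>?P\<^esub> ?r b = d"
    using d reduce_closed[of b] unfolding sum[symmetric]
    by (simp add: a_minus_def I.r_neg I.a_assoc)
  have "class_A a = class_A b \<longleftrightarrow> ?r a \<ominus>\<^bsub>?P\<^esub> ?r b \<in> residues_sum"
    unfolding class_A_def
    using I.quotient_eq_iff_same_a_r_cos[OF residues_sum_ideal reduce_closed reduce_closed] by blast
  also have "\<dots> \<longleftrightarrow> finite {p \<in> primes. d p \<noteq> 0}"
    unfolding minus using d
    by (simp add: residues_sum_def direct_sum_def residues_product_def residue_ring_def)
  also have "{p \<in> primes. d p \<noteq> 0} = {p \<in> primes. [a p \<noteq> b p] (mod int p)}"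
    by (auto simp: d_def cong_iff_dvd_diff dvd_eq_mod_eq_0)
  finally show ?thesis .
qed

lemma class_A_add: "class_A a \<oplus>\<^bsub>ring_A\<^esub> class_A b = class_A (\<lambda>p. a p + b p)"
proof -
  let ?P = residues_product
  interpret I: ideal residues_sum ?P by (rule residues_sum_ideal)
  have "class_A a \<oplus>\<^bsub>ring_A\<^esub> class_A b = residues_sum +>\<^bsub>?P\<^esub>
      ((\<lambda>p\<in>primes. a p mod int p) \<oplus>\<^bsub>?P\<^esub> (\<lambda>p\<in>primes. b p mod int p))"
    unfolding class_A_def ring_A_def FactRing_def
    by (simp add: I.a_rcos_sum reduce_closed)
  also have "(\<lambda>p\<in>primes. a p mod int p) \<oplus>\<^bsub>?P\<^esub> (\<lambda>p\<in>primes. b p mod int p) =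
      (\<lambda>p\<in>primes. (a p + b p) mod int p)"
    by (auto simp: residues_product_def product_ring_def residue_ring_def mod_simps fun_eq_iff)
  finally show ?thesis unfolding class_A_def .
qed

lemma class_A_mult: "class_A a \<otimes>\<^bsub>ring_A\<^esub> class_A b = class_A (\<lambda>p. a p * b p)"
proof -
  let ?P = residues_product
  interpret I: ideal residues_sum ?P by (rule residues_sum_ideal)
  have "class_A a \<otimes>\<^bsub>ring_A\<^esub> class_A b = residues_sum +>\<^bsub>?P\<^esub>
      ((\<lambda>p\<in>primes. a p mod int p) \<otimes>\<^bsub>?P\<^esub> (\<lambda>p\<in>primes. b p mod int p))"
    unfolding class_A_def ring_A_def FactRing_def
    by (simp add: I.rcoset_mult_add reduce_closed)
  also have "(\<lambda>p\<in>primes. a p mod int p) \<otimes>\<^bsub>?P\<^esub> (\<lambda>p\<in>primes. b p mod int p) =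
      (\<lambda>p\<in>primes. (a p * b p) mod int p)"
    by (auto simp: residues_product_def product_ring_def residue_ring_def mod_simps fun_eq_iff)
  finally show ?thesis unfolding class_A_def .
qed

lemma class_A_one: "class_A (\<lambda>p. 1) = \<one>\<^bsub>ring_A\<^esub>"
proof -
  have "(\<lambda>p\<in>primes. 1 mod int p) = \<one>\<^bsub>residues_product\<^esub>"
    using prime_gt_1_nat
    by (auto simp: residues_product_def product_ring_def residue_ring_def intro!: restrict_ext)
  then show ?thesis by (simp add: class_A_def ring_A_def FactRing_def)
qed

lemma finite_primes_dvd:
  assumes "b \<noteq> (0::int)"
  shows "finite {p \<in> primes. int p dvd b}"
proof (rule finite_subset)
  show "{p \<in> primes. int p dvd b} \<subseteq> {..nat \<bar>b\<bar>}"
    using assms by (auto dest!: zdvd_imp_le[OF dvd_abs_iff[THEN iffD2]])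
qed simp

lemma prime_coprime_int: "p \<in> primes \<Longrightarrow> \<not> int p dvd d \<Longrightarrow> coprime d (int p)"
  using prime_imp_coprime[of "int p" d] by (simp add: coprime_commute)

lemma rat_A_fraction:
  assumes b: "b \<noteq> 0"
  shows "rat_A (of_int a / of_int b) = class_A (\<lambda>p. a * modular_inverse (int p) b)"
proof -
  obtain c d where q: "quotient_of (of_int a / of_int b) = (c, d)" by fastforce
  have d: "d \<noteq> 0" using quotient_of_denom_pos[OF q] by simp
  have "(of_int a / of_int b :: rat) = of_int c / of_int d" by (rule quotient_of_div[OF q])
  then have "(of_int (a * d) :: rat) = of_int (c * b)" using b d by (simp add: field_simps)
  then have cross: "a * d = c * b" by (simp only: of_int_eq_iff)
  have "{p \<in> primes. [c * modular_inverse (int p) d \<noteq> a * modular_inverse (int p) b] (mod int p)}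
      \<subseteq> {p \<in> primes. int p dvd b * d}"
  proof
    fix p assume p: "p \<in> {p \<in> primes. [c * modular_inverse (int p) d \<noteq>
        a * modular_inverse (int p) b] (mod int p)}"
    have "int p dvd b * d"
    proof (rule ccontr)
      assume n: "\<not> int p dvd b * d"
      then have "\<not> int p dvd b" "\<not> int p dvd d" by auto
      then have cb: "coprime b (int p)" and cd: "coprime d (int p)"
        using p prime_coprime_int by blast+
      let ?m = "modular_inverse (int p)"
      have "[c * ?m d = c * ?m d * (b * ?m b)] (mod int p)"
        using cong_scalar_left[OF cong_modular_inverse1[OF cb], of "c * ?m d"]
        by (simp add: cong_sym)
      also have "c * ?m d * (b * ?m b) = a * ?m b * (d * ?m d)"
        using arg_cong[OF cross, of "\<lambda>x. x * (?m d * ?m b)"] by (simp only: ac_simps)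
      also have "[a * ?m b * (d * ?m d) = a * ?m b] (mod int p)"
        using cong_scalar_left[OF cong_modular_inverse1[OF cd], of "a * ?m b"] by simp
      finally show False using p by simp
    qed
    then show "p \<in> {p \<in> primes. int p dvd b * d}" using p by simp
  qed
  then have "finite {p \<in> primes. [c * modular_inverse (int p) d \<noteq>
      a * modular_inverse (int p) b] (mod int p)}"
    using finite_primes_dvd[of "b * d"] b d by (auto intro: finite_subset)
  then show ?thesis by (simp add: rat_A_def q class_A_eq_iff)
qed

lemma rat_common_denominator:
  fixes r s :: rat
  obtains a b d where "d \<noteq> 0" "r = of_int a / of_int d" "s = of_int b / of_int d"
proof -
  obtain a1 b1 a2 b2 where q: "quotient_of r = (a1, b1)" "quotient_of s = (a2, b2)" by fastforce
  have "b1 \<noteq> 0" "b2 \<noteq> 0" using q[THEN quotient_of_denom_pos] by auto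
  then show thesis
    using that[of "b1 * b2" "a1 * b2" "a2 * b1"] q[THEN quotient_of_div] by simp
qed

lemma rat_A_one: "rat_A 1 = \<one>\<^bsub>ring_A\<^esub>"
proof -
  have c: "[1 * modular_inverse (int p) 1 = 1] (mod int p)" for p
    by (rule cong_modular_inverse1) simp
  have "rat_A 1 = class_A (\<lambda>p. 1 * modular_inverse (int p) 1)"
    using rat_A_fraction[of 1 1] by (simp only: of_int_1 div_by_1)
  also have "\<dots> = class_A (\<lambda>p. 1)"
    unfolding class_A_eq_iff using c by (simp only: not_True_eq_False) simp
  finally show ?thesis by (simp only: class_A_one)
qed

lemma rat_A_add: "rat_A (r + s) = rat_A r \<oplus>\<^bsub>ring_A\<^esub> rat_A s"
proof -
  obtain a b d where d: "d \<noteq> 0" and r: "r = of_int a / of_int d" and s: "s = of_int b / of_int d"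
    by (rule rat_common_denominator)
  have rs: "r + s = of_int (a + b) / of_int d" by (simp add: r s add_divide_distrib)
  show ?thesis
    unfolding rs rat_A_fraction[OF d] unfolding r s rat_A_fraction[OF d] class_A_add
    by (simp only: distrib_right)
qed

lemma rat_A_mult: "rat_A (r * s) = rat_A r \<otimes>\<^bsub>ring_A\<^esub> rat_A s"
proof -
  obtain a b d where d: "d \<noteq> 0" and r: "r = of_int a / of_int d" and s: "s = of_int b / of_int d"
    by (rule rat_common_denominator)
  have rs: "r * s = of_int (a * b) / of_int (d * d)" by (simp add: r s)
  have dd: "d * d \<noteq> 0" using d by simp
  have "[a * b * modular_inverse (int p) (d * d) =
      a * modular_inverse (int p) d * (b * modular_inverse (int p) d)] (mod int p)"
    if p: "p \<in> primes" "\<not> int p dvd d" for p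
  proof -
    let ?m = "modular_inverse (int p)"
    have c: "coprime d (int p)" using prime_coprime_int p by blast
    then have c2: "coprime (d * d) (int p)" by simp
    have "[?m (d * d) * ((d * ?m d) * (d * ?m d)) = ?m (d * d) * (1 * 1)] (mod int p)"
      by (intro cong_scalar_left cong_mult cong_modular_inverse1 c)
    then have 1: "[?m (d * d) * (1 * 1) = ?m (d * d) * ((d * ?m d) * (d * ?m d))] (mod int p)"
      by (rule cong_sym)
    have 2: "[?m d * ?m d * ((d * d) * ?m (d * d)) = ?m d * ?m d * 1] (mod int p)"
      by (intro cong_scalar_left cong_modular_inverse1 c2)
    have 3: "?m (d * d) * ((d * ?m d) * (d * ?m d)) = ?m d * ?m d * ((d * d) * ?m (d * d))"
      by (simp only: ac_simps)
    have "[?m (d * d) = ?m d * ?m d] (mod int p)"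
      using cong_trans[OF 1[unfolded 3] 2] by (simp only: mult_1_right)
    then have "[a * b * ?m (d * d) = a * b * (?m d * ?m d)] (mod int p)"
      by (rule cong_scalar_left)
    then show ?thesis by (simp only: ac_simps)
  qed
  then have "{p \<in> primes. [a * b * modular_inverse (int p) (d * d) \<noteq>
      a * modular_inverse (int p) d * (b * modular_inverse (int p) d)] (mod int p)} \<subseteq>
      {p \<in> primes. int p dvd d}"
    by blast
  then have "finite {p \<in> primes. [a * b * modular_inverse (int p) (d * d) \<noteq>
      a * modular_inverse (int p) d * (b * modular_inverse (int p) d)] (mod int p)}"
    using finite_primes_dvd[OF d] by (rule finite_subset)
  then show ?thesis
    unfolding rs rat_A_fraction[OF dd] unfolding r s rat_A_fraction[OF d] class_A_mult
    by (simp only: class_A_eq_iff)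
qed

lemma rat_A_inj: "inj rat_A"
proof (rule injI)
  fix r s assume eq: "rat_A r = rat_A s"
  obtain a b d where d: "d \<noteq> 0" and r: "r = of_int a / of_int d" and s: "s = of_int b / of_int d"
    by (rule rat_common_denominator)
  let ?B = "{p \<in> primes. [a * modular_inverse (int p) d \<noteq> b * modular_inverse (int p) d] (mod int p)}"
  have fB: "finite ?B"
    using eq unfolding r s rat_A_fraction[OF d] class_A_eq_iff .
  have "int p dvd a - b" if p: "p \<in> primes" "\<not> int p dvd d" "p \<notin> ?B" for p
  proof -
    let ?m = "modular_inverse (int p)"
    have c: "coprime d (int p)" using prime_coprime_int p by blast
    have "[a * ?m d = b * ?m d] (mod int p)" using p by blast
    then have "[a = b] (mod int p)"
      using coprime_modular_inverse[OF c] cong_mult_rcancel by blast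
    then show ?thesis by (simp add: cong_iff_dvd_diff)
  qed
  then have "primes \<subseteq> {p \<in> primes. int p dvd a - b} \<union> {p \<in> primes. int p dvd d} \<union> ?B" by blast
  moreover have "infinite primes" by (rule primes_infinite)
  ultimately have "infinite {p \<in> primes. int p dvd a - b}"
    using fB finite_primes_dvd[OF d] by (meson finite_Un finite_subset)
  then have "a - b = 0" using finite_primes_dvd[of "a - b"] by blast
  then show "r = s" by (simp add: r s)
qed

end

theory Submission
  imports Defs "HOL-Computational_Algebra.Polynomial" "HOL-Real_Asymp.Real_Asymp"
begin

text \<open>
  If \<open>\<pi>(p)\<close> were integral over the rationals, clearing denominators would give a nonzero integer
  polynomial \<open>F\<close>, of degree \<open>d\<close> say, with \<open>p dvd F(\<pi>(p))\<close> for all large primes \<open>p\<close>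
  (\<open>integral_imp_integer_polynomial\<close>). So \<open>\<Phi>(x, y) = F(x) / y\<close> is integral at the points
  \<open>(\<pi>(p), p)\<close>. These points are so dense that they contain cubes with many short edges, and a mixed
  difference of \<open>\<Phi>\<close> over a suitable subcube turns out to be a nonzero integer below 1 in absolute value.

  Density: by Chebyshev's lower bound, at least \<open>N / (8 r)\<close> primes lie between \<open>2\<^sup>r\<close> and
  \<open>N = 4\<^sup>r\<close>. Pigeonholing on the difference vectors of nearby points and iterating gives a base point
  \<open>(n, p)\<close> and \<open>2 d\<close> integer vectors \<open>(a, k)\<close> of size at most \<open>K\<close>, a power of \<open>8 r\<close>,
  such that all vertices of the cube that they span at \<open>(n, p)\<close> are points of the
  graph (\<open>dense_graph_contains_cube\<close>), and \<open>p > 2\<^sup>r\<close>.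

  Smallness: for any slope \<open>\<theta>\<close> the quotient \<open>(F(x) - F(x - \<theta> y)) / y\<close> is a polynomial of
  total degree below \<open>d\<close>, so \<open>d\<close> differences annihilate it and \<open>\<Phi>\<close> may be replaced by
  \<open>F(x - \<theta> y) / y\<close> (\<open>mdiff_poly_div\<close>). With \<open>\<theta> = n / p\<close> the linear form \<open>x - \<theta> y\<close>
  vanishes at the base point and is at most \<open>d K\<close> on a subcube with \<open>d\<close> edges, so the difference
  is of size a power of \<open>K\<close> divided by \<open>p\<close>. Being an integer, it is zero.

  Nonvanishing: up to a relative error \<open>K\<^sup>O\<^sup>(\<^sup>1\<^sup>) / p\<close> the same difference equals
  \<open>c d! / p\<close> times the product of the numbers \<open>a - \<theta> k\<close>, where \<open>c\<close> is the leading coefficient.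
  It is therefore nonzero if \<open>d\<close> of the edges satisfy \<open>\<bar>a - \<theta> k\<bar> \<ge> 1 / (2 K)\<close>.
  Otherwise \<open>d\<close> edges violate this, and two such edges are parallel, since
  distinct fractions with denominators up to \<open>K\<close> are not that close. Taking for \<open>\<theta>\<close> their common
  slope makes \<open>x - \<theta> y\<close> constant, equal to \<open>u\<close> say, and the difference becomes \<open>F(u)\<close>
  times a difference of \<open>1 / y\<close>, which never vanishes. Finally \<open>F(u) \<noteq> 0\<close>: a rational root
  of \<open>F\<close> of this shape would force \<open>p \<le> B (\<pi>(p) + R)\<close> with constants \<open>B\<close>, \<open>R\<close>
  (\<open>rational_root_bound\<close>), against \<open>\<pi>(p) = o(p)\<close>, which is Chebyshev's upper bound.
\<close>

section \<open>Mixed differences over cubes\<close>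

definition delta :: "real \<times> real \<Rightarrow> (real \<Rightarrow> real \<Rightarrow> real) \<Rightarrow> real \<Rightarrow> real \<Rightarrow> real" where
  "delta v g x y = g (x + fst v) (y + snd v) - g x y"

primrec mdiff :: "(real \<times> real) list \<Rightarrow> (real \<Rightarrow> real \<Rightarrow> real) \<Rightarrow> real \<Rightarrow> real \<Rightarrow> real" where
  "mdiff [] g = g"
| "mdiff (v # vs) g = mdiff vs (delta v g)"

text \<open>
  The \<open>2\<^sup>n\<close> vertices are counted with multiplicity, so that the definition follows the recursion
  of \<open>mdiff\<close> and needs no assumption of independence of the edges.
\<close>
primrec cube :: "(real \<Rightarrow> real \<Rightarrow> bool) \<Rightarrow> (real \<times> real) list \<Rightarrow> real \<Rightarrow> real \<Rightarrow> bool" where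
  "cube P [] = P"
| "cube P (v # vs) = (\<lambda>x y. cube P vs x y \<and> cube P vs (x + fst v) (y + snd v))"

lemma cube_conj: "cube (\<lambda>x y. P x y \<and> Q x y) vs x y \<longleftrightarrow> cube P vs x y \<and> cube Q vs x y"
  by (induction vs arbitrary: x y) auto

lemma cube_mono:
  assumes "cube P vs x y" "\<And>x y. P x y \<Longrightarrow> Q x y"
  shows "cube Q vs x y"
  using assms by (induction vs arbitrary: x y) auto

lemma cube_vertex: "cube P vs x y \<Longrightarrow> P x y"
  by (induction vs arbitrary: x y) auto

lemma cube_shift: "cube (\<lambda>x y. P (x + a) (y + b)) vs x y \<longleftrightarrow> cube P vs (x + a) (y + b)"
  by (induction vs arbitrary: x y) (auto simp: algebra_simps)

lemma cube_filter: "cube P vs x y \<Longrightarrow> cube P (filter Q vs) x y"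
  by (induction vs arbitrary: x y) auto

lemma cube_take: "cube P vs x y \<Longrightarrow> cube P (take m vs) x y"
proof (induction vs arbitrary: m x y)
  case (Cons v vs)
  then show ?case by (cases m) (auto dest: cube_vertex)
qed auto

lemma cube_pos:
  assumes "y > 0" "\<And>v. v \<in> set vs \<Longrightarrow> snd v \<ge> 0"
  shows "cube (\<lambda>x y. y > 0) vs x y"
  using assms
proof (induction vs arbitrary: x y)
  case (Cons v vs)
  have "y + snd v > 0" using Cons.prems by (simp add: add_pos_nonneg)
  then show ?case using Cons by simp
qed simp

text \<open>
  Along the cube the linear form \<open>x - \<theta> y\<close> and the ordinate \<open>y\<close> change by at most the sum
  of their changes along the edges.
\<close>
lemma cube_box:
  fixes L K :: real
  assumes "\<And>v. v \<in> set vs \<Longrightarrow> \<bar>fst v - \<theta> * snd v\<bar> \<le> L \<and> 0 \<le> snd v \<and> snd v \<le> K"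
  shows "cube (\<lambda>x' y'. \<bar>(x' - \<theta> * y') - (x - \<theta> * y)\<bar> \<le> length vs * L \<and> y \<le> y' \<and> y' \<le> y + length vs * K)
    vs x y"
  using assms
proof (induction vs arbitrary: x y)
  case (Cons v vs)
  have v: "\<bar>fst v - \<theta> * snd v\<bar> \<le> L" "0 \<le> snd v" "snd v \<le> K" using Cons.prems by auto
  then have nn: "0 \<le> L" "0 \<le> K" by auto
  note IH = Cons.IH[OF Cons.prems[OF list.set_intros(2)]]
  show ?case
    unfolding cube.simps
    by (intro conjI; rule cube_mono[OF IH]; use v nn in \<open>simp add: algebra_simps abs_le_iff\<close>)
qed simp

text \<open>
  Difference operators commute, so the one that is applied first by definition can also be
  applied last. This form sees only the vertices of the cube.
\<close>
lemma mdiff_Cons_vertex: "mdiff (v # vs) g x y = mdiff vs g (x + fst v) (y + snd v) - mdiff vs g x y"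
proof (induction vs arbitrary: g x y)
  case (Cons w vs)
  have "delta w (delta v g) = delta v (delta w g)"
    by (simp add: delta_def fun_eq_iff algebra_simps)
  then show ?case using Cons.IH[of "delta w g"] by simp
qed (simp add: delta_def)

lemma mdiff_cong:
  assumes "cube (\<lambda>x y. g x y = h x y) vs x y"
  shows "mdiff vs g x y = mdiff vs h x y"
  using assms
proof (induction vs arbitrary: x y)
  case (Cons v vs)
  then show ?case by (simp only: mdiff_Cons_vertex cube.simps)
qed simp

lemma mdiff_Ints:
  assumes "cube (\<lambda>x y. g x y \<in> \<int>) vs x y"
  shows "mdiff vs g x y \<in> \<int>"
  using assms
proof (induction vs arbitrary: x y)
  case (Cons v vs)
  then show ?case by (simp only: mdiff_Cons_vertex cube.simps Ints_diff)
qed simp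

lemma mdiff_bound:
  assumes "cube (\<lambda>x y. \<bar>g x y\<bar> \<le> c) vs x y"
  shows "\<bar>mdiff vs g x y\<bar> \<le> 2 ^ length vs * c"
  using assms
proof (induction vs arbitrary: x y)
  case (Cons v vs)
  have "\<bar>mdiff vs g (x + fst v) (y + snd v)\<bar> \<le> 2 ^ length vs * c" "\<bar>mdiff vs g x y\<bar> \<le> 2 ^ length vs * c"
    using Cons by auto
  then show ?case by (simp only: mdiff_Cons_vertex) simp
qed simp

lemma mdiff_add: "mdiff vs (\<lambda>x y. g x y + h x y) x y = mdiff vs g x y + mdiff vs h x y"
  by (induction vs arbitrary: x y) (simp_all only: mdiff_Cons_vertex, simp_all)

lemma mdiff_diff: "mdiff vs (\<lambda>x y. g x y - h x y) x y = mdiff vs g x y - mdiff vs h x y"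
  by (induction vs arbitrary: x y) (simp_all only: mdiff_Cons_vertex, simp_all)

lemma mdiff_cmult: "mdiff vs (\<lambda>x y. c * g x y) x y = c * mdiff vs g x y"
  by (induction vs arbitrary: x y) (simp_all only: mdiff_Cons_vertex, simp_all add: algebra_simps)

lemma mdiff_zero: "mdiff vs (\<lambda>x y. 0) x y = 0"
  using mdiff_cmult[of vs 0 "\<lambda>x y. 0"] by simp

section \<open>Functions annihilated by a given number of differences\<close>

text \<open>
  The order plays the part of a strict bound on the total degree, without a type of bivariate polynomials.
\<close>
definition killed :: "nat \<Rightarrow> (real \<Rightarrow> real \<Rightarrow> real) \<Rightarrow> bool" where
  "killed n g \<longleftrightarrow> (\<forall>vs x y. length vs = n \<longrightarrow> mdiff vs g x y = 0)"

lemma killed_0_iff: "killed 0 g \<longleftrightarrow> g = (\<lambda>x y. 0)"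
  by (auto simp: killed_def fun_eq_iff)

lemma killed_Suc_iff: "killed (Suc n) g \<longleftrightarrow> (\<forall>v. killed n (delta v g))"
proof
  assume "killed (Suc n) g"
  then have "mdiff (v # vs) g x y = 0" if "length vs = n" for v vs x y
    using that unfolding killed_def by (metis length_Cons)
  then show "\<forall>v. killed n (delta v g)" unfolding killed_def by (metis mdiff.simps(2))
next
  assume *: "\<forall>v. killed n (delta v g)"
  show "killed (Suc n) g"
    unfolding killed_def
  proof (intro allI impI)
    fix vs :: "(real \<times> real) list" and x y assume "length vs = Suc n"
    then obtain v ws where vs: "vs = v # ws" and "length ws = n" by (auto simp only: length_Suc_conv)
    then show "mdiff vs g x y = 0" using * by (simp only: killed_def mdiff.simps)
  qed
qed

lemma killed_Suc: "killed n g \<Longrightarrow> killed (Suc n) g"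
  unfolding killed_def length_Suc_conv by (auto simp: mdiff_Cons_vertex simp del: mdiff.simps)

lemma killed_mono:
  assumes "killed m g" "m \<le> n"
  shows "killed n g"
  using assms(2,1) by (induction rule: dec_induct) (auto intro: killed_Suc)

lemma killed_add: "killed n g \<Longrightarrow> killed n h \<Longrightarrow> killed n (\<lambda>x y. g x y + h x y)"
  by (simp add: killed_def mdiff_add)

lemma killed_cmult: "killed n g \<Longrightarrow> killed n (\<lambda>x y. c * g x y)"
  by (simp add: killed_def mdiff_cmult)

lemma killed_shift:
  assumes "killed n g"
  shows "killed n (\<lambda>x y. g (x + a) (y + b))"
proof -
  have "mdiff vs (\<lambda>x y. g (x + a) (y + b)) x y = mdiff vs g (x + a) (y + b)" for vs x y
    by (induction vs arbitrary: x y) (simp_all only: mdiff_Cons_vertex, simp_all add: algebra_simps)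
  then show ?thesis using assms by (simp add: killed_def)
qed

lemma killed_const: "killed (Suc 0) (\<lambda>x y. c)"
  by (simp add: killed_Suc_iff killed_0_iff delta_def fun_eq_iff)

text \<open>
  Product rule: the difference of \<open>l * g\<close> along \<open>v\<close> is \<open>l\<close> times the difference of \<open>g\<close>
  plus a constant multiple of a translate of \<open>g\<close>. The first term is handled by induction on the order.
\<close>
lemma killed_mult_linear:
  assumes "killed n g"
  shows "killed (Suc n) (\<lambda>x y. (a * x + b * y) * g x y)"
  using assms
proof (induction n arbitrary: g)
  case 0
  then show ?case by (simp add: killed_0_iff killed_def mdiff_zero)
next
  case (Suc n)
  show ?case
    unfolding killed_Suc_iff[of "Suc n"]
  proof
    fix v
    have eq: "delta v (\<lambda>x y. (a * x + b * y) * g x y) =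
      (\<lambda>x y. (a * x + b * y) * delta v g x y + (a * fst v + b * snd v) * g (x + fst v) (y + snd v))"
      by (simp add: delta_def fun_eq_iff algebra_simps)
    show "killed (Suc n) (delta v (\<lambda>x y. (a * x + b * y) * g x y))"
      unfolding eq using Suc.prems Suc.prems[unfolded killed_Suc_iff, rule_format, of v]
      by (intro killed_add killed_cmult killed_shift Suc.IH)
  qed
qed

lemma killed_poly_linear:
  fixes F :: "real poly"
  shows "killed (Suc (Polynomial.degree F)) (\<lambda>x y. poly F (x - \<theta> * y))"
proof (induction F rule: pCons_induct)
  case 0
  then show ?case using killed_const[of 0] by simp
next
  case (pCons c F)
  have "killed (Suc (Polynomial.degree (pCons c F))) (\<lambda>x y. (1 * x + (- \<theta>) * y) * poly F (x - \<theta> * y))"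
  proof (cases "F = 0")
    case True
    then show ?thesis by (simp add: killed_def mdiff_zero)
  next
    case False
    then show ?thesis using killed_mult_linear[OF pCons.IH, of 1 "- \<theta>"] by (simp only: degree_pCons_eq if_False simp_thms)
  qed
  moreover have "killed (Suc (Polynomial.degree (pCons c F))) (\<lambda>x y. c)"
    using killed_const by (rule killed_mono) simp
  ultimately have "killed (Suc (Polynomial.degree (pCons c F)))
      (\<lambda>x y. c + (1 * x + (- \<theta>) * y) * poly F (x - \<theta> * y))" by (intro killed_add)
  then show ?case by (simp add: algebra_simps)
qed

text \<open>
  For \<open>F = c + X F'\<close> and \<open>u = x - \<theta> y\<close> the difference \<open>F(x) - F(u)\<close> is
  \<open>x (F'(x) - F'(u)) + \<theta> y F'(u)\<close>. So the quotient by \<open>y\<close> is built from linear forms and has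
  total degree below that of \<open>F\<close>.
\<close>
lemma poly_diff_quotient_killed:
  fixes F :: "real poly"
  obtains G where "killed (Polynomial.degree F) G"
    "\<And>x y. poly F x - poly F (x - \<theta> * y) = y * G x y"
proof -
  have "\<exists>G. killed (Polynomial.degree F) G \<and> (\<forall>x y. poly F x - poly F (x - \<theta> * y) = y * G x y)"
  proof (induction F rule: pCons_induct)
    case 0
    show ?case by (intro exI[of _ "\<lambda>x y. 0"]) (simp add: killed_def mdiff_zero)
  next
    case (pCons c F)
    then obtain G where G: "killed (Polynomial.degree F) G"
      "\<And>x y. poly F x - poly F (x - \<theta> * y) = y * G x y" by blast
    show ?case
    proof (cases "F = 0")
      case True
      then show ?thesis by (intro exI[of _ "\<lambda>x y. 0"]) (simp add: killed_def mdiff_zero)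
    next
      case False
      let ?H = "\<lambda>x y. (1 * x + 0 * y) * G x y + \<theta> * poly F (x - \<theta> * y)"
      have "killed (Suc (Polynomial.degree F)) ?H"
        by (intro killed_add killed_cmult killed_mult_linear killed_poly_linear G(1))
      moreover have "poly (pCons c F) x - poly (pCons c F) (x - \<theta> * y) = y * ?H x y" for x y
      proof -
        have "poly (pCons c F) x - poly (pCons c F) (x - \<theta> * y) =
          x * (poly F x - poly F (x - \<theta> * y)) + \<theta> * y * poly F (x - \<theta> * y)"
          by (simp add: algebra_simps)
        then show ?thesis unfolding G(2) by (simp add: algebra_simps)
      qed
      moreover have "Polynomial.degree (pCons c F) = Suc (Polynomial.degree F)"
        using False by (rule degree_pCons_eq)
      ultimately show ?thesis by (intro exI[of _ ?H]) auto
    qed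
  qed
  then show ?thesis using that by blast
qed

text \<open>
  The freedom to choose \<open>\<theta>\<close> is the heart of the proof: the slope of the line from the origin to the
  base point makes the right hand side small, the slope of parallel edges makes its numerator constant.
\<close>
lemma mdiff_poly_div:
  fixes F :: "real poly"
  assumes "length vs = Polynomial.degree F" "y > 0" "\<And>v. v \<in> set vs \<Longrightarrow> snd v \<ge> 0"
  shows "mdiff vs (\<lambda>x y. poly F x / y) x y = mdiff vs (\<lambda>x y. poly F (x - \<theta> * y) / y) x y"
proof -
  obtain G where G: "killed (Polynomial.degree F) G"
    "\<And>x y. poly F x - poly F (x - \<theta> * y) = y * G x y"
    using poly_diff_quotient_killed[of F \<theta>] by blast
  have "cube (\<lambda>x y. y > 0) vs x y" using assms(2,3) by (rule cube_pos)
  then have "cube (\<lambda>x y. poly F x / y - poly F (x - \<theta> * y) / y = G x y) vs x y"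
    by (rule cube_mono) (simp add: diff_divide_distrib[symmetric] G(2))
  then have "mdiff vs (\<lambda>x y. poly F x / y - poly F (x - \<theta> * y) / y) x y = mdiff vs G x y"
    by (rule mdiff_cong)
  also have "\<dots> = 0" using G(1) assms(1) by (simp add: killed_def)
  finally show ?thesis by (simp add: mdiff_diff)
qed

text \<open>
  The top coefficients of \<open>p(X + w)\<close> and \<open>p\<close> agree, and the next one grows by the contribution
  of the top one, as in \<open>(X + w)\<^sup>n = X\<^sup>n + n w X\<^sup>n\<^sup>-\<^sup>1 + \<dots>\<close>.
\<close>
lemma degree_coeff_shift_diff:
  fixes p :: "real poly"
  assumes "Polynomial.degree p \<le> Suc n"
  shows "Polynomial.degree (pcompose p [:w, 1:] - p) \<le> n"
    and "Polynomial.coeff (pcompose p [:w, 1:] - p) n = real (Suc n) * w * Polynomial.coeff p (Suc n)"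
proof -
  have deg: "Polynomial.degree (pcompose q [:w, 1:]) = Polynomial.degree q" for q :: "real poly"
    by (simp add: degree_pcompose)
  have top: "Polynomial.coeff (pcompose q [:w, 1:]) m = Polynomial.coeff q m"
    if "Polynomial.degree q \<le> m" for q :: "real poly" and m
    using that
  proof (cases "Polynomial.degree q = m")
    case True
    have "Polynomial.lead_coeff (pcompose q [:w, 1:]) = Polynomial.lead_coeff q"
      by (subst lead_coeff_comp) auto
    then show ?thesis using True deg by simp
  qed (simp add: coeff_eq_0 deg)
  have sub: "Polynomial.coeff (pcompose q [:w, 1:] - q) m = real (Suc m) * w * Polynomial.coeff q (Suc m)"
    if "Polynomial.degree q \<le> Suc m" for q :: "real poly" and m
    using that
  proof (induction q arbitrary: m rule: pCons_induct)
    case (pCons c q)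
    then have dq: "Polynomial.degree q \<le> m" by (cases "q = 0") auto
    show ?case
    proof (cases m)
      case 0
      then show ?thesis using top[OF dq] by (simp add: pcompose_pCons)
    next
      case (Suc k)
      then show ?thesis using pCons.IH[of k] dq top[OF dq]
        by (simp add: pcompose_pCons algebra_simps)
    qed
  qed simp
  show "Polynomial.coeff (pcompose p [:w, 1:] - p) n = real (Suc n) * w * Polynomial.coeff p (Suc n)"
    using sub assms .
  show "Polynomial.degree (pcompose p [:w, 1:] - p) \<le> n"
  proof (rule degree_le, intro allI impI)
    fix i assume i: "n < i"
    then have "Polynomial.degree p \<le> i" using assms by simp
    then show "Polynomial.coeff (pcompose p [:w, 1:] - p) i = 0"
      using top[of p i] by simp
  qed
qed

text \<open>
  Along an edge the linear form changes by a constant, so each difference lowers the degree by one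
  and multiplies the top coefficient by the current degree and that constant.
\<close>
lemma mdiff_poly_top:
  fixes p :: "real poly"
  assumes "Polynomial.degree p \<le> length vs"
  shows "mdiff vs (\<lambda>x y. poly p (x - \<theta> * y)) x y =
    Polynomial.coeff p (length vs) * fact (length vs) * prod_list (map (\<lambda>v. fst v - \<theta> * snd v) vs)"
  using assms
proof (induction vs arbitrary: p)
  case Nil
  then obtain c where "p = [:c:]" by (auto elim: degree_eq_zeroE)
  then show ?case by simp
next
  case (Cons v vs)
  let ?q = "pcompose p [:fst v - \<theta> * snd v, 1:] - p"
  have dp: "Polynomial.degree p \<le> Suc (length vs)" using Cons.prems by simp
  have "delta v (\<lambda>x y. poly p (x - \<theta> * y)) = (\<lambda>x y. poly ?q (x - \<theta> * y))"
    by (simp add: delta_def fun_eq_iff poly_pcompose algebra_simps)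
  then have "mdiff (v # vs) (\<lambda>x y. poly p (x - \<theta> * y)) x y = mdiff vs (\<lambda>x y. poly ?q (x - \<theta> * y)) x y"
    by (simp only: mdiff.simps)
  also have "\<dots> = Polynomial.coeff ?q (length vs) * fact (length vs) *
      prod_list (map (\<lambda>v. fst v - \<theta> * snd v) vs)"
    by (rule Cons.IH[OF degree_coeff_shift_diff(1)[OF dp]])
  finally show ?case
    unfolding degree_coeff_shift_diff(2)[OF dp] by simp
qed

section \<open>Differences of the reciprocal\<close>

text \<open>
  An algebraic stand-in for completely monotone functions: it contains the reciprocal, its members are positive,
  and it is closed under negated forward differences (\<open>cone_decrement\<close>).
\<close>
inductive cone :: "(real \<Rightarrow> real) \<Rightarrow> bool" where
  inv: "c \<ge> 0 \<Longrightarrow> cone (\<lambda>y. 1 / (y + c))"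
| scale: "c > 0 \<Longrightarrow> cone g \<Longrightarrow> cone (\<lambda>y. c * g y)"
| add: "cone g \<Longrightarrow> cone h \<Longrightarrow> cone (\<lambda>y. g y + h y)"
| mult: "cone g \<Longrightarrow> cone h \<Longrightarrow> cone (\<lambda>y. g y * h y)"

lemma cone_pos: "cone g \<Longrightarrow> y > 0 \<Longrightarrow> g y > 0"
  by (induction rule: cone.induct) auto

lemma cone_shift: "cone g \<Longrightarrow> k \<ge> 0 \<Longrightarrow> cone (\<lambda>y. g (y + k))"
proof (induction rule: cone.induct)
  case (inv c)
  then show ?case using cone.inv[of "k + c"] by (simp add: add.assoc)
qed (auto intro: cone.intros)

text \<open>
  For the generators this is \<open>1 / (y + c) - 1 / (y + k + c) = k / ((y + c) (y + k + c))\<close>, for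
  products the telescoping \<open>g h - g' h' = (g - g') h + g' (h - h')\<close>.
\<close>
lemma cone_decrement:
  assumes "cone g" "k > 0"
  obtains h where "cone h" "\<And>y. y > 0 \<Longrightarrow> g y - g (y + k) = h y"
proof -
  have "\<exists>h. cone h \<and> (\<forall>y>0. g y - g (y + k) = h y)"
    using assms
  proof (induction rule: cone.induct)
    case (inv c)
    have "cone (\<lambda>y. k * (1 / (y + c) * (1 / (y + (k + c)))))"
      using inv by (intro cone.intros) auto
    moreover have "1 / (y + c) - 1 / (y + k + c) = k * (1 / (y + c) * (1 / (y + (k + c))))"
      if "y > 0" for y
      using that inv by (simp add: field_simps)
    ultimately show ?case by blast
  next
    case (scale c g)
    then obtain h where "cone h" "\<forall>y>0. g y - g (y + k) = h y" by blast
    then show ?case using scale.hyps(1)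
      by (intro exI[of _ "\<lambda>y. c * h y"]) (auto intro: cone.scale simp: right_diff_distrib[symmetric])
  next
    case (add g1 g2)
    then obtain h1 h2 where "cone h1" "\<forall>y>0. g1 y - g1 (y + k) = h1 y"
      "cone h2" "\<forall>y>0. g2 y - g2 (y + k) = h2 y" by blast
    then show ?case
      by (intro exI[of _ "\<lambda>y. h1 y + h2 y"]) (auto intro: cone.add simp: algebra_simps)
  next
    case (mult g1 g2)
    then obtain h1 h2 where h: "cone h1" "\<forall>y>0. g1 y - g1 (y + k) = h1 y"
      "cone h2" "\<forall>y>0. g2 y - g2 (y + k) = h2 y" by blast
    have "cone (\<lambda>y. h1 y * g2 y + g1 (y + k) * h2 y)"
      using h mult by (intro cone.intros cone_shift) auto
    moreover have "g1 y * g2 y - g1 (y + k) * g2 (y + k) = h1 y * g2 y + g1 (y + k) * h2 y"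
      if "y > 0" for y
    proof -
      have "h1 y = g1 y - g1 (y + k)" "h2 y = g2 y - g2 (y + k)" using h that by auto
      then show ?thesis by (simp only:) (simp add: algebra_simps)
    qed
    ultimately show ?case by blast
  qed
  then show ?thesis using that by blast
qed

lemma mdiff_cone:
  assumes "cone g" "y > 0" "\<And>v. v \<in> set vs \<Longrightarrow> snd v > 0"
  shows "(- 1) ^ length vs * mdiff vs (\<lambda>x y. g y) x y > 0"
  using assms
proof (induction vs arbitrary: g x)
  case Nil
  then show ?case using cone_pos by simp
next
  case (Cons v vs)
  have v: "snd v > 0" using Cons.prems by simp
  obtain h where h: "cone h" "\<And>y. y > 0 \<Longrightarrow> g y - g (y + snd v) = h y"
    using cone_decrement[OF Cons.prems(1) v] by metis
  have "cube (\<lambda>x y. y > 0) vs x y"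
    using Cons.prems(2) Cons.prems(3)[OF list.set_intros(2), THEN less_imp_le] by (rule cube_pos)
  then have "cube (\<lambda>x y. delta v (\<lambda>x y. g y) x y = (- 1) * h y) vs x y"
    by (rule cube_mono) (simp add: delta_def h(2)[symmetric])
  then have "mdiff (v # vs) (\<lambda>x y. g y) x y = - mdiff vs (\<lambda>x y. h y) x y"
    using mdiff_cong mdiff_cmult[of vs "- 1" "\<lambda>x y. h y"] by fastforce
  then show ?case using Cons.IH[OF h(1) Cons.prems(2)] Cons.prems(3) by simp
qed

lemma mdiff_inverse_nonzero:
  assumes "y > 0" "\<And>v. v \<in> set vs \<Longrightarrow> snd v > 0"
  shows "mdiff vs (\<lambda>x y. 1 / y) x y \<noteq> 0"
  using mdiff_cone[of "\<lambda>y. 1 / (y + 0)" y vs x] cone.inv[of 0] assms by auto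

section \<open>Cubes with short edges carry no integral quotients\<close>

text \<open>
  The edges that occur between points \<open>(\<pi>(p), p)\<close>: integral, with \<open>\<pi>\<close> growing by at least
  one and at most as fast as its argument.
\<close>
definition step_le :: "nat \<Rightarrow> real \<times> real \<Rightarrow> bool" where
  "step_le K v \<longleftrightarrow> (\<exists>a k :: nat. v = (real a, real k) \<and> 1 \<le> a \<and> a \<le> k \<and> k \<le> K)"

lemma step_le_mono: "step_le K v \<Longrightarrow> K \<le> L \<Longrightarrow> step_le L v"
  unfolding step_le_def by (blast intro: order_trans)

lemma step_leD:
  assumes "step_le K v"
  shows "0 < fst v" "fst v \<le> snd v" "0 < snd v" "snd v \<le> real K"
  using assms by (auto simp: step_le_def)

lemma poly_growth_bound:
  fixes F :: "real poly"
  obtains A where "A \<ge> 1" "\<And>x T. T \<ge> 1 \<Longrightarrow> \<bar>x\<bar> \<le> T \<Longrightarrow> \<bar>poly F x\<bar> \<le> A * T ^ Polynomial.degree F"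
proof
  let ?d = "Polynomial.degree F"
  let ?A = "1 + (\<Sum>i\<le>?d. \<bar>Polynomial.coeff F i\<bar>)"
  show "?A \<ge> 1" by (simp add: sum_nonneg)
  fix x T :: real assume T: "T \<ge> 1" "\<bar>x\<bar> \<le> T"
  have "\<bar>poly F x\<bar> \<le> (\<Sum>i\<le>?d. \<bar>Polynomial.coeff F i * x ^ i\<bar>)"
    unfolding poly_altdef by (rule sum_abs)
  also have "\<dots> \<le> (\<Sum>i\<le>?d. \<bar>Polynomial.coeff F i\<bar> * T ^ ?d)"
  proof (rule sum_mono)
    fix i assume i: "i \<in> {..?d}"
    have "\<bar>x\<bar> ^ i \<le> T ^ i" using T by (intro power_mono) auto
    also have "\<dots> \<le> T ^ ?d" using T i by (intro power_increasing) auto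
    finally show "\<bar>Polynomial.coeff F i * x ^ i\<bar> \<le> \<bar>Polynomial.coeff F i\<bar> * T ^ ?d"
      by (simp add: abs_mult power_abs mult_left_mono)
  qed
  also have "\<dots> = (\<Sum>i\<le>?d. \<bar>Polynomial.coeff F i\<bar>) * T ^ ?d" by (rule sum_distrib_right[symmetric])
  also have "\<dots> \<le> ?A * T ^ ?d" using T by (intro mult_right_mono) auto
  finally show "\<bar>poly F x\<bar> \<le> ?A * T ^ ?d" .
qed

text \<open>
  Here \<open>\<theta> = x / y\<close>, so that \<open>x - \<theta> y\<close> is zero at the base point and at most \<open>T\<close> on the
  cube. For the second estimate the denominator is replaced by its value \<open>y\<close> at the base point, which costs a
  factor \<open>T / y\<close>, and \<open>mdiff_poly_top\<close> evaluates what remains.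
\<close>
lemma mdiff_quotient_estimates:
  fixes F :: "real poly" and K :: nat and T x y :: real
  defines "d \<equiv> Polynomial.degree F"
  defines "T \<equiv> real d * real K + 1"
  assumes A: "\<And>x T. T \<ge> 1 \<Longrightarrow> \<bar>x\<bar> \<le> T \<Longrightarrow> \<bar>poly F x\<bar> \<le> A * T ^ d"
  assumes vs: "length vs = d" "\<And>v. v \<in> set vs \<Longrightarrow> step_le K v"
  assumes xy: "0 \<le> x" "x \<le> y" "0 < y"
  shows "\<bar>mdiff vs (\<lambda>x y. poly F x / y) x y\<bar> \<le> 2 ^ d * (A * T ^ d / y)"
    and "\<bar>y * mdiff vs (\<lambda>x y. poly F x / y) x y -
      Polynomial.lead_coeff F * fact d * prod_list (map (\<lambda>v. fst v - x / y * snd v) vs)\<bar>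
      \<le> 2 ^ d * (A * T ^ d * T / y)"
proof -
  define \<theta> where "\<theta> = x / y"
  have \<theta>: "0 \<le> \<theta>" "\<theta> \<le> 1" "x - \<theta> * y = 0" using xy by (auto simp: \<theta>_def field_simps)
  have T1: "T \<ge> 1" by (simp add: T_def)
  have A0: "0 \<le> A * T ^ d" using A[of T 0] T1 abs_ge_zero[of "poly F 0"] by linarith
  have eq: "mdiff vs (\<lambda>x y. poly F x / y) x y = mdiff vs (\<lambda>x y. poly F (x - \<theta> * y) / y) x y"
    using vs(1) xy(3) step_leD(3)[OF vs(2)] unfolding d_def by (intro mdiff_poly_div less_imp_le)
  have "\<bar>fst v - \<theta> * snd v\<bar> \<le> real K \<and> 0 \<le> snd v \<and> snd v \<le> real K" if "v \<in> set vs" for v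
  proof -
    note v = step_leD[OF vs(2)[OF that]]
    have "0 \<le> \<theta> * snd v" "\<theta> * snd v \<le> 1 * snd v"
      using \<theta> v by (auto intro: mult_right_mono)
    then show ?thesis using v by linarith
  qed
  then have box: "cube (\<lambda>x' y'. \<bar>(x' - \<theta> * y') - (x - \<theta> * y)\<bar> \<le> length vs * real K \<and> y \<le> y' \<and>
      y' \<le> y + length vs * real K) vs x y"
    by (rule cube_box)
  have pt: "\<bar>poly F (x' - \<theta> * y') / y'\<bar> \<le> A * T ^ d / y \<and>
      \<bar>y * (poly F (x' - \<theta> * y') / y') - poly F (x' - \<theta> * y')\<bar> \<le> A * T ^ d * T / y"
    if *: "\<bar>(x' - \<theta> * y') - (x - \<theta> * y)\<bar> \<le> length vs * real K \<and> y \<le> y' \<and>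
      y' \<le> y + length vs * real K" for x' y'
  proof -
    let ?f = "poly F (x' - \<theta> * y')"
    have y': "y' > 0" using * xy by linarith
    have "\<bar>x' - \<theta> * y'\<bar> \<le> T" using * \<theta>(3) vs(1) by (simp add: T_def)
    then have f: "\<bar>?f\<bar> \<le> A * T ^ d" using A T1 by blast
    have inv: "1 / y' \<le> 1 / y" using * xy by (simp add: field_simps)
    have "\<bar>?f / y'\<bar> = \<bar>?f\<bar> * (1 / y')" using y' by simp
    also have "\<dots> \<le> (A * T ^ d) * (1 / y)" using f inv y' A0 by (intro mult_mono) auto
    finally have 1: "\<bar>?f / y'\<bar> \<le> A * T ^ d / y" by simp
    have "y * (?f / y') - ?f = (?f / y') * (y - y')" using y' by (simp add: field_simps)
    then have "\<bar>y * (?f / y') - ?f\<bar> = \<bar>?f / y'\<bar> * \<bar>y - y'\<bar>" by (simp only: abs_mult)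
    also have "\<dots> \<le> (A * T ^ d / y) * T"
      using 1 * A0 xy vs(1) by (intro mult_mono) (auto simp: T_def)
    finally show ?thesis using 1 by simp
  qed
  have c1: "cube (\<lambda>x' y'. \<bar>poly F (x' - \<theta> * y') / y'\<bar> \<le> A * T ^ d / y) vs x y"
    using box by (rule cube_mono) (use pt in blast)
  show "\<bar>mdiff vs (\<lambda>x y. poly F x / y) x y\<bar> \<le> 2 ^ d * (A * T ^ d / y)"
    unfolding eq using mdiff_bound[OF c1] by (simp only: vs(1))
  have c2: "cube (\<lambda>x' y'. \<bar>y * (poly F (x' - \<theta> * y') / y') - poly F (x' - \<theta> * y')\<bar> \<le> A * T ^ d * T / y) vs x y"
    using box by (rule cube_mono) (use pt in blast)
  have "mdiff vs (\<lambda>x' y'. y * (poly F (x' - \<theta> * y') / y') - poly F (x' - \<theta> * y')) x y =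
      y * mdiff vs (\<lambda>x y. poly F x / y) x y -
      Polynomial.lead_coeff F * fact d * prod_list (map (\<lambda>v. fst v - x / y * snd v) vs)"
    unfolding mdiff_diff[of vs "\<lambda>x' y'. y * (poly F (x' - \<theta> * y') / y')"]
      mdiff_cmult[of vs y "\<lambda>x' y'. poly F (x' - \<theta> * y') / y'"] eq
    using mdiff_poly_top[of F vs \<theta> x y] vs(1) by (simp add: d_def \<theta>_def)
  then show "\<bar>y * mdiff vs (\<lambda>x y. poly F x / y) x y -
      Polynomial.lead_coeff F * fact d * prod_list (map (\<lambda>v. fst v - x / y * snd v) vs)\<bar>
      \<le> 2 ^ d * (A * T ^ d * T / y)"
    using mdiff_bound[OF c2] by (simp only: vs(1))
qed

text \<open>
  The numerator \<open>F(x - \<theta> y)\<close> is constant on the cube and comes out of the difference.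
\<close>
lemma mdiff_quotient_parallel_nonzero:
  fixes F :: "real poly"
  assumes "length vs = Polynomial.degree F" "\<And>v. v \<in> set vs \<Longrightarrow> snd v > 0 \<and> fst v = \<theta> * snd v"
    and y: "y > 0" and nz: "poly F (x - \<theta> * y) \<noteq> 0"
  shows "mdiff vs (\<lambda>x y. poly F x / y) x y \<noteq> 0"
proof -
  define K where "K = Max (insert 0 (snd ` set vs))"
  have "snd v \<le> K" if "v \<in> set vs" for v using that unfolding K_def by (intro Max_ge) auto
  then have "\<bar>fst v - \<theta> * snd v\<bar> \<le> 0 \<and> 0 \<le> snd v \<and> snd v \<le> K" if "v \<in> set vs" for v
    using assms(2)[OF that] that by (simp add: less_imp_le)
  then have box: "cube (\<lambda>x' y'. \<bar>(x' - \<theta> * y') - (x - \<theta> * y)\<bar> \<le> real (length vs) * 0 \<and> y \<le> y' \<and>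
      y' \<le> y + length vs * K) vs x y"
    by (rule cube_box)
  have c: "cube (\<lambda>x' y'. poly F (x' - \<theta> * y') / y' = poly F (x - \<theta> * y) * (1 / y')) vs x y"
    using box by (rule cube_mono) simp
  have "mdiff vs (\<lambda>x y. poly F x / y) x y = mdiff vs (\<lambda>x y. poly F (x - \<theta> * y) / y) x y"
    using assms by (intro mdiff_poly_div) (auto simp: less_imp_le)
  also have "\<dots> = poly F (x - \<theta> * y) * mdiff vs (\<lambda>x y. 1 / y) x y"
    using mdiff_cong[OF c] mdiff_cmult[of vs "poly F (x - \<theta> * y)" "\<lambda>x y. 1 / y"] by (rule trans)
  also have "\<dots> \<noteq> 0" using nz mdiff_inverse_nonzero[OF y, of vs x] assms(2) by auto
  finally show ?thesis .
qed

text \<open>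
  The determinant of two such vectors is an integer, and it is below 1 because both are close to the line
  of slope \<open>\<theta>\<close>.
\<close>
lemma near_parallel_steps_parallel:
  assumes "step_le K v" "step_le K w"
    and "\<bar>fst v - \<theta> * snd v\<bar> < 1 / (2 * real K)" "\<bar>fst w - \<theta> * snd w\<bar> < 1 / (2 * real K)"
  shows "fst v * snd w = fst w * snd v"
proof -
  obtain a k a' k' :: nat where v: "v = (real a, real k)" "1 \<le> k" "k \<le> K"
    and w: "w = (real a', real k')" "1 \<le> k'" "k' \<le> K"
    using assms(1,2) unfolding step_le_def using order_trans by blast
  have K: "real K > 0" using v by simp
  have *: "real j * \<bar>z\<bar> < 1 / 2" if "1 \<le> j" "j \<le> K" "\<bar>z\<bar> < 1 / (2 * real K)" for j :: nat and z :: real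
  proof -
    have "real j * \<bar>z\<bar> \<le> real K * \<bar>z\<bar>" using that by (intro mult_right_mono) auto
    also have "\<dots> < real K * (1 / (2 * real K))" using that K by (intro mult_strict_left_mono)
    also have "\<dots> = 1 / 2" using K by simp
    finally show ?thesis .
  qed
  \<comment> \<open>The determinant is unchanged when the multiples of the direction \<open>(\<theta>, 1)\<close> are removed.\<close>
  have "real a * real k' - real a' * real k =
      real k' * (real a - \<theta> * real k) - real k * (real a' - \<theta> * real k')"
    by (simp add: algebra_simps)
  also have "\<bar>\<dots>\<bar> \<le> real k' * \<bar>real a - \<theta> * real k\<bar> + real k * \<bar>real a' - \<theta> * real k'\<bar>"
    by (rule order_trans[OF abs_triangle_ineq4]) (simp add: abs_mult)
  also have "\<dots> < 1"
    using *[OF w(2,3), of "real a - \<theta> * real k"] *[OF v(2,3), of "real a' - \<theta> * real k'"] assms(3,4) v w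
    by simp
  finally have "\<bar>real_of_int (int a * int k' - int a' * int k)\<bar> < 1" by simp
  then have "int a * int k' - int a' * int k = 0" by linarith
  then have "real_of_int (int a * int k') = real_of_int (int a' * int k)" by simp
  then show ?thesis using v w by simp
qed

lemma Ints_abs_less_1: "z \<in> \<int> \<Longrightarrow> \<bar>z :: real\<bar> < 1 \<Longrightarrow> z = 0"
  by (auto elim!: Ints_cases)

text \<open>
  Twice as many edges as the degree guarantee that \<open>d\<close> of them are all close to the direction of the base point
  or all bounded away from it. Either way the difference over these edges is nonzero, although it is an integer of size below 1.
\<close>
lemma no_integral_cube:
  fixes F :: "real poly" and K :: nat and x y :: real
  defines "d \<equiv> Polynomial.degree F"
  assumes lead: "\<bar>Polynomial.lead_coeff F\<bar> \<ge> 1"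
  assumes A: "A \<ge> 1" "\<And>x T. T \<ge> 1 \<Longrightarrow> \<bar>x\<bar> \<le> T \<Longrightarrow> \<bar>poly F x\<bar> \<le> A * T ^ d"
  assumes vs: "length vs = 2 * d" "\<And>v. v \<in> set vs \<Longrightarrow> step_le K v" and K: "K \<ge> 1"
  assumes xy: "0 \<le> x" "x \<le> y"
  assumes large: "2 ^ d * (A * (real d * real K + 1) ^ (d + 1)) * (2 * real K) ^ d < y"
  assumes roots: "\<And>a k :: nat. 1 \<le> a \<Longrightarrow> 1 \<le> k \<Longrightarrow> k \<le> K \<Longrightarrow> poly F (x - real a / real k * y) \<noteq> 0"
  shows "\<not> cube (\<lambda>x y. poly F x / y \<in> \<int>) vs x y"
proof
  assume cube: "cube (\<lambda>x y. poly F x / y \<in> \<int>) vs x y"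
  define T where "T = real d * real K + 1"
  have T1: "T \<ge> 1" by (simp add: T_def)
  define M where "M = 2 ^ d * (A * T ^ d * T)"
  have M: "M \<ge> 0" using A(1) T1 by (simp add: M_def)
  have large': "M * (2 * real K) ^ d < y" using large by (simp add: M_def T_def mult.assoc mult.left_commute)
  have K2: "1 \<le> (2 * real K) ^ d" using K by (intro one_le_power) simp
  have "M \<le> M * (2 * real K) ^ d" using M K2 mult_left_mono[of 1 _ M] by simp
  then have My: "M < y" using large' by linarith
  have y: "y > 0" using M My by linarith
  define bad where "bad v \<longleftrightarrow> \<bar>fst v - x / y * snd v\<bar> < 1 / (2 * real K)" for v
  have len: "length (filter bad vs) + length (filter (\<lambda>v. \<not> bad v) vs) = 2 * d"
    using sum_length_filter_compl[of bad vs] vs(1) by simp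
  have vanish: "mdiff ws (\<lambda>x y. poly F x / y) x y = 0"
    if ws: "length ws = d" "set ws \<subseteq> set vs" "cube (\<lambda>x y. poly F x / y \<in> \<int>) ws x y" for ws
  proof (rule Ints_abs_less_1)
    show "mdiff ws (\<lambda>x y. poly F x / y) x y \<in> \<int>" by (rule mdiff_Ints) (rule ws(3))
    have "\<bar>mdiff ws (\<lambda>x y. poly F x / y) x y\<bar> \<le> 2 ^ d * (A * T ^ d / y)"
      unfolding T_def d_def using A(2) ws vs(2) xy y
      by (intro mdiff_quotient_estimates(1)) (auto simp: d_def)
    also have "\<dots> = 2 ^ d * (A * T ^ d) / y" by simp
    also have "\<dots> \<le> M / y"
      unfolding M_def using y T1 A(1) mult_left_mono[of 1 T "2 ^ d * (A * T ^ d)"]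
      by (intro divide_right_mono) (simp_all add: mult.assoc)
    also have "\<dots> < 1" using My y by simp
    finally show "\<bar>mdiff ws (\<lambda>x y. poly F x / y) x y\<bar> < 1" .
  qed
  show False
  proof (cases "d \<le> length (filter bad vs)")
    case True
    define ws where "ws = take d (filter bad vs)"
    have ws: "length ws = d" "set ws \<subseteq> set vs" using True by (auto simp: ws_def dest: in_set_takeD)
    have wbad: "bad w" if "w \<in> set ws" for w using that by (auto simp: ws_def dest: in_set_takeD)
    have "cube (\<lambda>x y. poly F x / y \<in> \<int>) ws x y" unfolding ws_def by (intro cube_take cube_filter cube)
    then have zero: "mdiff ws (\<lambda>x y. poly F x / y) x y = 0" using vanish ws by blast
    \<comment> \<open>For \<open>d = 0\<close> there are no edges and any slope will do.\<close>
    obtain a k :: nat where ak: "1 \<le> a" "1 \<le> k" "k \<le> K"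
      "\<And>w. w \<in> set ws \<Longrightarrow> fst w = real a / real k * snd w"
    proof (cases "ws = []")
      case True
      then show ?thesis using that[of 1 1] K by simp
    next
      case False
      define v where "v = hd ws"
      have v: "v \<in> set ws" using False by (simp add: v_def)
      then have sv: "step_le K v" using vs(2) ws(2) by blast
      then obtain a k :: nat where ak: "v = (real a, real k)" "1 \<le> a" "a \<le> k" "k \<le> K"
        unfolding step_le_def by blast
      have "fst w = real a / real k * snd w" if "w \<in> set ws" for w
      proof -
        have "fst v * snd w = fst w * snd v"
          using near_parallel_steps_parallel[OF sv vs(2)] wbad[OF v] wbad[OF that] ws(2) that
          unfolding bad_def by blast
        then show ?thesis using ak by (simp add: field_simps)
      qed
      then show ?thesis using that[of a k] ak by simp
    qed
    have "mdiff ws (\<lambda>x y. poly F x / y) x y \<noteq> 0"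
    proof (rule mdiff_quotient_parallel_nonzero[of _ _ "real a / real k"])
      show "snd w > 0 \<and> fst w = real a / real k * snd w" if "w \<in> set ws" for w
        using ak(4)[OF that] step_leD(3)[OF vs(2)] ws(2) that by blast
    qed (use ws(1) y roots[OF ak(1-3)] in \<open>simp_all add: d_def\<close>)
    with zero show False by simp
  next
    case False
    define ws where "ws = take d (filter (\<lambda>v. \<not> bad v) vs)"
    have ws: "length ws = d" "set ws \<subseteq> set vs" using False len by (auto simp: ws_def dest: in_set_takeD)
    have good: "1 / (2 * real K) \<le> \<bar>fst w - x / y * snd w\<bar>" if "w \<in> set ws" for w
      using that by (auto simp: ws_def bad_def dest!: in_set_takeD)
    have "cube (\<lambda>x y. poly F x / y \<in> \<int>) ws x y" unfolding ws_def by (intro cube_take cube_filter cube)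
    then have zero: "mdiff ws (\<lambda>x y. poly F x / y) x y = 0" using vanish ws by blast
    let ?P = "prod_list (map (\<lambda>v. fst v - x / y * snd v) ws)"
    have "\<bar>y * mdiff ws (\<lambda>x y. poly F x / y) x y - Polynomial.lead_coeff F * fact d * ?P\<bar>
        \<le> 2 ^ d * (A * T ^ d * T / y)"
      unfolding T_def d_def using A(2) ws vs(2) xy y
      by (intro mdiff_quotient_estimates(2)) (auto simp: d_def)
    then have up: "\<bar>Polynomial.lead_coeff F * fact d * ?P\<bar> \<le> M / y" using zero by (simp add: M_def)
    have "(1 / (2 * real K)) ^ length ws \<le> \<bar>?P\<bar>" using good
    proof (induction ws)
      case (Cons w ws)
      have "1 / (2 * real K) * (1 / (2 * real K)) ^ length ws \<le>
          \<bar>fst w - x / y * snd w\<bar> * \<bar>prod_list (map (\<lambda>v. fst v - x / y * snd v) ws)\<bar>"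
        by (rule mult_mono) (use Cons in auto)
      then show ?case by (simp only: abs_mult list.map prod_list.Cons length_Cons power_Suc)
    qed simp
    also have "\<bar>?P\<bar> = 1 * 1 * \<bar>?P\<bar>" by simp
    also have "\<dots> \<le> \<bar>Polynomial.lead_coeff F\<bar> * fact d * \<bar>?P\<bar>"
      using lead by (intro mult_right_mono mult_mono fact_ge_1) auto
    also have "\<dots> \<le> M / y" using up by (simp add: abs_mult)
    finally have "(1 / (2 * real K)) ^ d \<le> M / y" using ws(1) by simp
    then have "y * (1 / (2 * real K)) ^ d \<le> M" using y by (simp add: field_simps)
    then have "y * (1 / (2 * real K)) ^ d * (2 * real K) ^ d \<le> M * (2 * real K) ^ d"
      using K2 by (intro mult_right_mono) auto
    moreover have "(1 / (2 * real K)) ^ d * (2 * real K) ^ d = 1"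
      unfolding power_mult_distrib[symmetric] using K by simp
    ultimately have "y \<le> M * (2 * real K) ^ d" by (simp only: mult.assoc mult_1_right)
    then show False using large' by linarith
  qed
qed

section \<open>Cubes in dense subsets of a graph\<close>

text \<open>
  Cut \<open>{..N}\<close> into blocks of length \<open>K\<close>. At most one element in each block has no larger element
  of \<open>S\<close> in its block; for the others choose such an element and pigeonhole on the difference
  vector, which has at most \<open>K\<^sup>2\<close> values.
\<close>
lemma popular_difference:
  fixes f :: "nat \<Rightarrow> nat"
  assumes S: "S \<subseteq> {..N}" and K: "K > 0" and dense: "2 * (N + K) \<le> card S * K"
    and strict: "strict_mono_on S f"
    and lip: "\<forall>s k. f (s + k) \<le> f s + k"
  shows "\<exists>a k. 1 \<le> a \<and> a \<le> k \<and> k \<le> K \<and>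
    N \<le> card {s \<in> S. s + k \<in> S \<and> f (s + k) = f s + a} * K ^ 3"
proof -
  have finS: "finite S" using S by (rule finite_subset) simp
  define T where "T = {s \<in> S. \<exists>t\<in>S. s < t \<and> t div K = s div K}"
  have TS: "T \<subseteq> S" by (auto simp: T_def)
  have "inj_on (\<lambda>s. s div K) (S - T)"
  proof (rule inj_onI)
    fix s t assume st: "s \<in> S - T" "t \<in> S - T" "s div K = t div K"
    then have "\<not> s < t" "\<not> t < s" unfolding T_def by force+
    then show "s = t" by simp
  qed
  moreover have "(\<lambda>s. s div K) ` (S - T) \<subseteq> {..N div K}"
    using S by (auto intro: div_le_mono)
  ultimately have "card (S - T) \<le> N div K + 1"
    using card_inj_on_le[of "\<lambda>s. s div K" "S - T" "{..N div K}"] by simp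
  then have "card (S - T) * K \<le> (N div K + 1) * K" by (rule mult_right_mono) simp
  also have "\<dots> \<le> N + K" by simp
  finally have "card (S - T) * K \<le> N + K" .
  moreover have "card S = card T + card (S - T)"
    using card_Int_Diff[OF finS, of T] Int_absorb1[OF TS] by simp
  ultimately have T: "N + K \<le> card T * K" using dense by (simp add: algebra_simps)
  have finT: "finite T" using finS by (simp add: T_def)
  obtain g where g: "\<And>s. s \<in> T \<Longrightarrow> g s \<in> S \<and> s < g s \<and> g s div K = s div K"
    using bchoice[of T "\<lambda>s t. t \<in> S \<and> s < t \<and> t div K = s div K"] by (auto simp: T_def)
  define h where "h s = (f (g s) - f s, g s - s)" for s
  define V where "V = {(a, k). 1 \<le> a \<and> a \<le> k \<and> k \<le> K}"
  have hV: "h ` T \<subseteq> V"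
  proof (rule image_subsetI)
    fix s assume s: "s \<in> T"
    then have sS: "s \<in> S" by (simp add: T_def)
    have "g s = g s div K * K + g s mod K" "s = g s div K * K + s mod K"
      using g[OF s] by (metis div_mult_mod_eq)+
    moreover have "g s mod K < K" using K by simp
    ultimately have "g s - s \<le> K" by linarith
    moreover have "f s < f (g s)" using strict_mono_onD[OF strict sS, of "g s"] g[OF s] by simp
    moreover have "f (g s) \<le> f s + (g s - s)" using lip[rule_format, of s "g s - s"] g[OF s] by simp
    ultimately show "h s \<in> V" by (auto simp: h_def V_def)
  qed
  have V: "V \<subseteq> {1..K} \<times> {1..K}" by (auto simp: V_def)
  then have finV: "finite V" by (rule finite_subset) simp
  have cV: "card V \<le> K * K" using card_mono[OF _ V] by simp
  define c where "c v = card {s \<in> T. h s = v}" for v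
  have sum_c: "(\<Sum>v\<in>V. c v) = card T"
    using sum.group[OF finT finV hV, of "\<lambda>_. 1::nat"] by (simp add: c_def)
  have "\<exists>v\<in>V. N \<le> c v * K ^ 3"
  proof (rule ccontr)
    assume "\<not> ?thesis"
    then have lt: "c v * K ^ 3 \<le> N" if "v \<in> V" for v using that by (meson nat_le_linear)
    have "(N + K) * (K * K) \<le> card T * K * (K * K)" using T by (rule mult_right_mono) simp
    also have "\<dots> = (\<Sum>v\<in>V. c v * K ^ 3)"
      by (simp add: sum_c[symmetric] sum_distrib_right power3_eq_cube mult.assoc)
    also have "\<dots> \<le> card V * N" using sum_bounded_above[of V "\<lambda>v. c v * K ^ 3" N] lt by simp
    also have "\<dots> \<le> K * K * N" using cV by (rule mult_right_mono) simp
    finally show False using K by (simp add: algebra_simps)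
  qed
  then obtain v where v: "v \<in> V" "N \<le> c v * K ^ 3" by (rule bexE)
  define a k where "a = fst v" and "k = snd v"
  have ak: "(a, k) \<in> V" "N \<le> c (a, k) * K ^ 3" using v by (simp_all add: a_def k_def)
  have "{s \<in> T. h s = (a, k)} \<subseteq> {s \<in> S. s + k \<in> S \<and> f (s + k) = f s + a}"
  proof
    fix s assume "s \<in> {s \<in> T. h s = (a, k)}"
    then have s: "s \<in> T" "f (g s) - f s = a" "g s - s = k" by (auto simp: h_def)
    have "s \<in> S" using s by (simp add: T_def)
    moreover have "g s = s + k" "f (g s) = f s + a" using g[OF s(1)] s strict_mono_onD[OF strict \<open>s \<in> S\<close>, of "g s"] by auto
    ultimately show "s \<in> {s \<in> S. s + k \<in> S \<and> f (s + k) = f s + a}" using g[OF s(1)] by auto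
  qed
  then have "c (a, k) \<le> card {s \<in> S. s + k \<in> S \<and> f (s + k) = f s + a}"
    unfolding c_def using finS by (intro card_mono) auto
  then have "c (a, k) * K ^ 3 \<le> card {s \<in> S. s + k \<in> S \<and> f (s + k) = f s + a} * K ^ 3"
    by (rule mult_right_mono) simp
  then have "N \<le> card {s \<in> S. s + k \<in> S \<and> f (s + k) = f s + a} * K ^ 3"
    using ak(2) by (rule order_trans[rotated])
  moreover have "1 \<le> a \<and> a \<le> k \<and> k \<le> K" using ak(1) by (simp add: V_def)
  ultimately show ?thesis by (intro exI[of _ a] exI[of _ k]) simp
qed

text \<open>
  Each application of \<open>popular_difference\<close> with \<open>K = 4 L\<close> yields one edge and passes to the set of its
  starting points, whose density is at least \<open>1 / (64 L\<^sup>3)\<close>. Since \<open>64 L\<^sup>3 \<le> L\<^sup>4\<close>, the inverse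
  density stays at most \<open>L\<close> raised to the power \<open>4\<^sup>m\<close> throughout.
\<close>
lemma dense_graph_contains_cube:
  fixes f :: "nat \<Rightarrow> nat"
  assumes "S \<subseteq> {..N}" "N \<le> card S * L" "64 \<le> L" "4 * L ^ (4 ^ m) \<le> N"
    and "strict_mono_on S f" "\<forall>s k. f (s + k) \<le> f s + k"
  shows "\<exists>vs s. length vs = m \<and> s \<in> S \<and>
    (\<forall>v\<in>set vs. step_le (L ^ (4 ^ m)) v) \<and>
    cube (\<lambda>x y. \<exists>t\<in>S. x = real (f t) \<and> y = real t) vs (real (f s)) (real s)"
  using assms
proof (induction m arbitrary: S L)
  case 0
  then have "S \<noteq> {}" by auto
  then show ?case by auto
next
  case (Suc m)
  note S = \<open>S \<subseteq> {..N}\<close> and L = \<open>64 \<le> L\<close> and N = \<open>4 * L ^ (4 ^ Suc m) \<le> N\<close>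
  note strict = Suc.prems(5) and lip = Suc.prems(6)
  have Lpow: "L ^ i \<le> L ^ (4 ^ Suc m)" if "i \<le> 4" for i
  proof (rule power_increasing)
    have "(4::nat) * 1 \<le> 4 * 4 ^ m" by (intro mult_left_mono) auto
    then show "i \<le> 4 ^ Suc m" using that by (simp only: power_Suc)
  qed (use L in simp)
  have "4 * L \<le> N" using Lpow[of 1] N by simp
  then have dense: "2 * (N + 4 * L) \<le> card S * (4 * L)" using Suc.prems(2) by simp
  have L0: "4 * L > 0" using L by simp
  obtain a k where ak: "1 \<le> a" "a \<le> k" "k \<le> 4 * L"
    and S': "N \<le> card {s \<in> S. s + k \<in> S \<and> f (s + k) = f s + a} * (4 * L) ^ 3"
    using popular_difference[OF S L0 dense strict lip] by (elim exE conjE)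
  let ?S' = "{s \<in> S. s + k \<in> S \<and> f (s + k) = f s + a}"
  let ?L' = "64 * L ^ 3"
  have L': "?L' \<le> L ^ 4"
  proof -
    have "64 * L ^ 3 \<le> L * L ^ 3" using L by (rule mult_right_mono) simp
    moreover have "L * L ^ 3 = L ^ 4" by (simp add: eval_nat_numeral)
    ultimately show ?thesis by simp
  qed
  have "?L' ^ (4 ^ m) \<le> (L ^ 4) ^ (4 ^ m)" using L' by (rule power_mono) simp
  then have L'm: "?L' ^ (4 ^ m) \<le> L ^ (4 ^ Suc m)" by (simp only: power_mult[symmetric] power_Suc)
  have sub: "?S' \<subseteq> {..N}" using S by blast
  have strict': "strict_mono_on ?S' f" using strict by (auto simp: strict_mono_on_def)
  have L64: "64 \<le> ?L'" using L by simp
  have dense': "N \<le> card ?S' * ?L'" using S' by (simp add: power_mult_distrib)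
  have room: "4 * ?L' ^ (4 ^ m) \<le> N" using L'm N by linarith
  have "\<exists>vs s. length vs = m \<and> s \<in> ?S' \<and>
    (\<forall>v\<in>set vs. step_le (?L' ^ (4 ^ m)) v) \<and>
    cube (\<lambda>x y. \<exists>t\<in>?S'. x = real (f t) \<and> y = real t) vs (real (f s)) (real s)"
    by (rule Suc.IH[OF sub dense' L64 room strict' lip])
  then obtain vs s where vs: "length vs = m" "s \<in> ?S'"
    "\<forall>v\<in>set vs. step_le (?L' ^ (4 ^ m)) v"
    "cube (\<lambda>x y. \<exists>t\<in>?S'. x = real (f t) \<and> y = real t) vs (real (f s)) (real s)"
    by (elim exE conjE)
  let ?P = "\<lambda>x y. \<exists>t\<in>S. x = real (f t) \<and> y = real t"
  have "cube (\<lambda>x y. ?P x y \<and> ?P (x + real a) (y + real k)) vs (real (f s)) (real s)"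
    using vs(4)
  proof (rule cube_mono)
    fix x y assume "\<exists>t\<in>?S'. x = real (f t) \<and> y = real t"
    then obtain t where t: "t \<in> S" "t + k \<in> S" "f (t + k) = f t + a" "x = real (f t)" "y = real t"
      by blast
    then have "x + real a = real (f (t + k))" "y + real k = real (t + k)" by simp_all
    with t show "?P x y \<and> ?P (x + real a) (y + real k)" by blast
  qed
  then have cb: "cube ?P ((real a, real k) # vs) (real (f s)) (real s)"
    by (simp only: cube_conj cube_shift[of ?P] cube.simps fst_conv snd_conv simp_thms)
  have "k \<le> L ^ (4 ^ Suc m)"
  proof -
    have "4 * L \<le> L * L" using L by (intro mult_right_mono) auto
    with ak(3) have "k \<le> L * L" by linarith
    then show ?thesis using Lpow[of 2] by (simp add: power2_eq_square)
  qed
  then have step: "step_le (L ^ (4 ^ Suc m)) (real a, real k)" using ak unfolding step_le_def by blast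
  have "step_le (L ^ (4 ^ Suc m)) v" if "v \<in> set ((real a, real k) # vs)" for v
  proof (cases "v = (real a, real k)")
    case True
    then show ?thesis using step by simp
  next
    case False
    then have "v \<in> set vs" using that by simp
    then show ?thesis by (rule step_le_mono[OF vs(3)[rule_format] L'm])
  qed
  then have all: "\<forall>v\<in>set ((real a, real k) # vs). step_le (L ^ (4 ^ Suc m)) v" by (rule ballI)
  have len: "length ((real a, real k) # vs) = Suc m" using vs(1) by simp
  have "s \<in> S" using vs(2) by simp
  then show ?case using cb all len
    by (intro exI[of _ "(real a, real k) # vs"] exI[of _ s] conjI)
qed

section \<open>Chebyshev bounds\<close>

text \<open>
  The reciprocals \<open>1 / ((n + 1) (n choose k))\<close> form Leibniz's harmonic triangle, in which every entry is a
  difference of two entries with smaller \<open>k\<close>. Hence a common multiple of the first column is one of the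
  whole triangle.
\<close>
lemma leibniz_triangle_dvd:
  fixes M :: nat
  assumes "k \<le> n" and "\<And>i. 1 \<le> i \<Longrightarrow> i \<le> Suc n \<Longrightarrow> i dvd M"
  shows "Suc n * (n choose k) dvd M"
  using assms
proof (induction k arbitrary: n)
  case 0
  then show ?case by simp
next
  case (Suc k)
  then obtain m where n: "n = Suc m" and km: "k \<le> m" by (cases n) auto
  define c where "c = real (m choose k)"
  have c: "c > 0" using km by (simp add: c_def)
  have "Suc m * (m choose k) dvd M" and "Suc n * (n choose k) dvd M"
    by (rule Suc.IH; use Suc.prems km n in simp)+
  then obtain u v where u: "M = Suc m * (m choose k) * u" and v: "M = Suc n * (n choose k) * v"
    unfolding dvd_def by blast
  have "Suc k * (Suc m choose Suc k) = Suc m * (m choose k)"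
    by (rule Suc_times_binomial)
  then have "real (Suc k * (Suc m choose Suc k)) = real (Suc m * (m choose k))" by (rule arg_cong)
  then have b1: "real (k + 1) * real (n choose Suc k) = real (m + 1) * c"
    by (simp add: n c_def algebra_simps)
  have "(Suc m - k) * (Suc m choose k) = Suc m * (m choose k)"
    using binomial_absorb_comp[of "Suc m" k] by simp
  then have "real ((Suc m - k) * (Suc m choose k)) = real (Suc m * (m choose k))" by (rule arg_cong)
  then have b2: "(real m + 1 - real k) * real (n choose k) = real (m + 1) * c"
    using km by (simp only: n c_def of_nat_mult of_nat_diff le_SucI of_nat_Suc) (simp add: algebra_simps)
  have pos: "real m + 1 - real k > 0" using km by simp
  have U: "real M = real (m + 1) * c * real u"
    using u by (simp add: c_def algebra_simps)
  have V: "(real m + 1 - real k) * real M = real (m + 2) * (real (m + 1) * c) * real v"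
  proof -
    have "(real m + 1 - real k) * real M =
      real (m + 2) * ((real m + 1 - real k) * real (n choose k)) * real v"
      using v n by (simp add: algebra_simps)
    then show ?thesis unfolding b2 .
  qed
  have "(real M * real (k + 1)) = real (m + 2) * (real (m + 1) * c) * (real u - real v)"
    using U V by (simp add: algebra_simps)
  then have "real (k + 1) * real M = real (k + 1) * (real (m + 2) * real (n choose Suc k) * (real u - real v))"
    unfolding b1[symmetric] by (simp only: ac_simps)
  then have "real M = real (m + 2) * real (n choose Suc k) * (real u - real v)"
    by (metis mult_left_cancel of_nat_eq_0_iff add_is_0 one_neq_zero)
  then have "real_of_int (int M) = real_of_int (int (Suc n * (n choose Suc k)) * (int u - int v))"
    by (simp add: n algebra_simps)
  then have "int M = int (Suc n * (n choose Suc k)) * (int u - int v)"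
    by (simp only: of_int_eq_iff)
  then have "int (Suc n * (n choose Suc k)) dvd int M" by (metis dvd_triv_left)
  then show ?case by (simp only: int_dvd_int_iff)
qed

lemma two_power_le_of_common_multiple:
  fixes M :: nat
  assumes "M > 0" "\<And>i. 1 \<le> i \<Longrightarrow> i \<le> Suc n \<Longrightarrow> i dvd M"
  shows "2 ^ n \<le> M"
proof -
  have "Suc n * 2 ^ n = (\<Sum>k\<le>n. Suc n * (n choose k))"
    by (simp only: sum_distrib_left[symmetric] choose_row_sum)
  also have "\<dots> \<le> (\<Sum>k\<le>n. M)"
    using leibniz_triangle_dvd[OF _ assms(2)] assms(1) by (intro sum_mono dvd_imp_le) auto
  also have "\<dots> = Suc n * M" by simp
  finally show ?thesis by (rule Suc_mult_le_cancel1[THEN iffD1])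
qed

text \<open>
  The least common multiple of \<open>1, \<dots>, n\<close> is a product of prime powers, one for each prime up to
  \<open>n\<close> and none exceeding \<open>n\<close>.
\<close>
lemma common_multiple_le_power_prime_counting:
  assumes n: "n > 0"
  obtains M :: nat where "M > 0" "\<And>i. 1 \<le> i \<Longrightarrow> i \<le> n \<Longrightarrow> i dvd M" "M \<le> n ^ prime_counting n"
proof -
  define P where "P = {q \<in> primes. q \<le> n}"
  have fP: "finite P" unfolding P_def by (rule finite_subset[of _ "{..n}"]) auto
  define e where "e p = Max (multiplicity p ` {1..n})" for p
  define M where "M = (\<Prod>p\<in>P. p ^ e p)"
  have le: "p ^ e p \<le> n" for p
  proof -
    have "e p \<in> multiplicity p ` {1..n}" unfolding e_def using n by (intro Max_in) auto
    then obtain i where i: "i \<in> {1..n}" "e p = multiplicity p i" by auto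
    have "p ^ multiplicity p i dvd i" by (rule multiplicity_dvd)
    then show ?thesis using i by (auto dest!: dvd_imp_le)
  qed
  show ?thesis
  proof (rule that)
    show "M > 0" unfolding M_def P_def by (intro prod_pos) (auto simp: prime_gt_0_nat)
    show "M \<le> n ^ prime_counting n"
      unfolding M_def prime_counting_def P_def[symmetric] using prod_mono[of P "\<lambda>p. p ^ e p" "\<lambda>_. n"] le
      by simp
    fix i assume i: "1 \<le> i" "i \<le> n"
    then have sub: "prime_factors i \<subseteq> P"
      by (auto simp: P_def prime_factors_dvd dest: dvd_imp_le)
    have "i = (\<Prod>p\<in>prime_factors i. p ^ multiplicity p i)"
      using prod_prime_factors[of i] i by simp
    also have "\<dots> dvd (\<Prod>p\<in>prime_factors i. p ^ e p)"
      using i by (intro prod_dvd_prod le_imp_power_dvd) (auto simp: e_def)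
    also have "\<dots> dvd M" unfolding M_def using sub fP by (intro prod_dvd_prod_subset)
    finally show "i dvd M" .
  qed
qed

lemma two_power_le_power_prime_counting: "2 ^ n \<le> Suc n ^ prime_counting (Suc n)"
proof -
  obtain M :: nat where "M > 0" "\<And>i. 1 \<le> i \<Longrightarrow> i \<le> Suc n \<Longrightarrow> i dvd M"
      "M \<le> Suc n ^ prime_counting (Suc n)"
    by (rule common_multiple_le_power_prime_counting[of "Suc n"]) auto
  then show ?thesis using two_power_le_of_common_multiple[of M n] by simp
qed

lemma prime_counting_two_power_lower: "2 ^ t \<le> t * prime_counting (2 ^ t) + 1"
proof -
  have "(2::nat) ^ (2 ^ t - 1) \<le> (2 ^ t) ^ prime_counting (2 ^ t)"
    using two_power_le_power_prime_counting[of "2 ^ t - 1"] by simp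
  then have "(2::nat) ^ (2 ^ t - 1) \<le> 2 ^ (t * prime_counting (2 ^ t))" by (simp add: power_mult)
  then show ?thesis by (simp add: power_increasing_iff)
qed

lemma prime_counting_Suc_le: "prime_counting (Suc n) \<le> Suc (prime_counting n)"
proof -
  let ?A = "{q \<in> primes. q \<le> n}"
  have fin: "finite ?A" by (rule finite_subset[of _ "{..n}"]) auto
  have "prime_counting (Suc n) \<le> card (insert (Suc n) ?A)"
    unfolding prime_counting_def using fin by (intro card_mono) auto
  also have "\<dots> \<le> Suc (card ?A)" by (rule card_insert_le_m1[of "Suc (card ?A)"]) simp_all
  finally show ?thesis by (simp add: prime_counting_def)
qed

lemma prod_primes_dvd:
  fixes m :: nat
  assumes "finite A" "A \<subseteq> primes" "\<And>p. p \<in> A \<Longrightarrow> p dvd m"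
  shows "\<Prod>A dvd m"
  using assms
proof (induction rule: finite_induct)
  case (insert p A)
  have "coprime p (\<Prod>A)"
    using insert by (intro prod_coprime_right) (auto intro!: primes_coprime)
  then show ?case using insert by (simp add: divides_mult)
qed auto

text \<open>
  All primes between \<open>n\<close> and \<open>2 n\<close> divide the central binomial coefficient, which is at most \<open>4\<^sup>n\<close>.
\<close>
lemma power_prime_counting_doubling:
  "n ^ (prime_counting (2 * n) - prime_counting n) \<le> 4 ^ n"
proof -
  define A where "A = {q \<in> primes. n < q \<and> q \<le> 2 * n}"
  have fin: "finite {q \<in> primes. q \<le> m}" for m by (rule finite_subset[of _ "{..m}"]) auto
  have "A = {q \<in> primes. q \<le> 2 * n} - {q \<in> primes. q \<le> n}" by (auto simp: A_def)
  then have cA: "card A = prime_counting (2 * n) - prime_counting n"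
    unfolding prime_counting_def by (simp add: card_Diff_subset fin Collect_mono_iff)
  have "p dvd (2 * n) choose n" if "p \<in> A" for p
  proof -
    have p: "Factorial_Ring.prime p" "n < p" "p \<le> 2 * n" using that by (auto simp: A_def)
    have "fact n * fact n * ((2 * n) choose n) = (fact (2 * n) :: nat)"
      using binomial_fact_lemma[of n "2 * n"] by simp
    moreover have "p dvd fact (2 * n)" using p by (simp add: prime_dvd_fact_iff)
    moreover have "\<not> p dvd fact n" using p by (simp add: prime_dvd_fact_iff)
    ultimately show ?thesis using p(1) by (metis prime_dvd_mult_iff)
  qed
  then have "\<Prod>A dvd ((2 * n) choose n)"
    by (intro prod_primes_dvd) (auto simp: A_def)
  then have "\<Prod>A \<le> (2 * n) choose n" by (intro dvd_imp_le) auto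
  also have "\<dots> \<le> (\<Sum>k\<le>2 * n. (2 * n) choose k)" by (rule member_le_sum) auto
  also have "\<dots> = 4 ^ n" by (simp only: choose_row_sum power_mult) simp
  finally have "\<Prod>A \<le> 4 ^ n" .
  moreover have "n ^ card A \<le> \<Prod>A"
    using prod_mono[of A "\<lambda>_. n" "\<lambda>p. p"] by (auto simp: A_def)
  ultimately show ?thesis by (simp add: cA)
qed

lemma prime_counting_le: "prime_counting n \<le> n"
proof -
  have "card {q \<in> primes. q \<le> n} \<le> card {1..n}"
    by (intro card_mono) (auto simp: Suc_le_eq prime_gt_0_nat)
  then show ?thesis by (simp add: prime_counting_def)
qed

text \<open>
  Halving repeatedly: between \<open>h\<close> and \<open>2 h\<close> there are at most \<open>h / (4 B)\<close> primes once
  \<open>h \<ge> 4\<^sup>4\<^sup>B\<close>, by the doubling estimate.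
\<close>
lemma prime_counting_sublinear:
  fixes B :: nat
  obtains N where "\<And>n. B * prime_counting n \<le> n + N"
proof -
  \<comment> \<open>For \<open>n \<ge> N0\<close> the base of the power in the doubling estimate absorbs the factor \<open>4 B\<close>.\<close>
  define N0 :: nat where "N0 = 4 ^ (4 * B)"
  define C where "C = B * (2 * N0 + 2)"
  have dbl: "4 * B * (prime_counting (2 * n) - prime_counting n) \<le> n" if "n \<ge> N0" for n
  proof -
    let ?e = "prime_counting (2 * n) - prime_counting n"
    have "(4::nat) ^ (4 * B * ?e) \<le> n ^ ?e"
      unfolding power_mult[of 4 "4 * B"] using that by (intro power_mono) (auto simp: N0_def)
    also have "\<dots> \<le> 4 ^ n" by (rule power_prime_counting_doubling)
    finally show ?thesis by simp
  qed
  have N0: "4 * B < N0" unfolding N0_def by (rule power_gt_expt) simp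
  have "B * prime_counting n \<le> n + C" for n
  proof (induction n rule: less_induct)
    case (less n)
    show ?case
    proof (cases "n < 2 * N0 + 2")
      case True
      then have "B * prime_counting n \<le> C"
        unfolding C_def using prime_counting_le[of n] by (intro mult_le_mono) auto
      then show ?thesis by simp
    next
      case False
      define h where "h = n div 2"
      have h: "h \<ge> N0" "h < n" "n = 2 * h \<or> n = Suc (2 * h)" using False by (auto simp: h_def)
      have "prime_counting n \<le> prime_counting h + (prime_counting (2 * h) - prime_counting h) + 1"
        using h(3) prime_counting_Suc_le[of "2 * h"] by auto
      then have "4 * B * prime_counting n \<le> 4 * B * (prime_counting h + (prime_counting (2 * h) - prime_counting h) + 1)"
        by (rule mult_left_mono) simp
      also have "\<dots> = 4 * (B * prime_counting h) + 4 * B * (prime_counting (2 * h) - prime_counting h) + 4 * B"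
        by (simp add: algebra_simps)
      also have "\<dots> \<le> 4 * (h + C) + h + h"
        using add_mono[OF add_mono[OF mult_left_mono[OF less.IH[OF h(2)], of 4] dbl[OF h(1)]], of "4 * B" h] N0 h(1)
        by simp
      finally have "4 * (B * prime_counting n) \<le> 4 * (n + C)" using h(3) by (auto simp add: mult.assoc)
      then show ?thesis by simp
    qed
  qed
  then show ?thesis by (rule that)
qed

lemma prime_counting_strict_mono: "strict_mono_on primes prime_counting"
proof (rule strict_mono_onI)
  fix s t :: nat assume st: "t \<in> primes" "s < t"
  have "finite {q \<in> primes. q \<le> t}" by (rule finite_subset[of _ "{..t}"]) auto
  moreover have "{q \<in> primes. q \<le> s} \<subset> {q \<in> primes. q \<le> t}"
  proof (rule psubsetI)
    show "{q \<in> primes. q \<le> s} \<noteq> {q \<in> primes. q \<le> t}"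
      using st by (metis (mono_tags, lifting) mem_Collect_eq not_le order_refl)
  qed (use st in auto)
  ultimately show "prime_counting s < prime_counting t"
    unfolding prime_counting_def by (rule psubset_card_mono)
qed

lemma prime_counting_add_le: "prime_counting (s + k) \<le> prime_counting s + k"
proof (induction k)
  case (Suc k)
  then show ?case using prime_counting_Suc_le[of "s + k"] by simp
qed simp

text \<open>
  The lower bound for \<open>\<pi>(4\<^sup>r)\<close> exceeds the number \<open>2\<^sup>r\<close> of integers that are discarded by a wide margin.
\<close>
lemma many_primes:
  assumes "8 * r \<le> 2 ^ r" "r > 0"
  shows "4 ^ r \<le> card {p \<in> primes. 2 ^ r < p \<and> p \<le> 4 ^ r} * (8 * r)"
proof -
  let ?S = "{p \<in> primes. 2 ^ r < p \<and> p \<le> (4::nat) ^ r}"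
  have four: "(4::nat) ^ r = 2 ^ (2 * r)" "(4::nat) ^ r = 2 ^ r * 2 ^ r"
    by (simp_all add: power_mult power_mult_distrib[symmetric])
  have fin: "finite {p \<in> primes. p \<le> n}" for n by (rule finite_subset[of _ "{..n}"]) auto
  have "prime_counting (4 ^ r) \<le> card ({p \<in> primes. p \<le> 2 ^ r} \<union> ?S)"
    unfolding prime_counting_def using fin by (intro card_mono) auto
  also have "\<dots> \<le> prime_counting (2 ^ r) + card ?S"
    unfolding prime_counting_def by (rule card_Un_le)
  also have "\<dots> \<le> 2 ^ r + card ?S" using prime_counting_le by simp
  finally have "2 * r * prime_counting (4 ^ r) \<le> 2 * r * (2 ^ r + card ?S)" by (rule mult_left_mono) simp
  moreover have "4 ^ r \<le> 2 * r * prime_counting (4 ^ r) + 1"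
    using prime_counting_two_power_lower[of "2 * r"] by (simp only: four(1))
  ultimately have "4 ^ r \<le> 2 * r * 2 ^ r + 2 * r * card ?S + 1" by (simp add: algebra_simps)
  then have "4 * 4 ^ r \<le> 4 * (2 * r * 2 ^ r + 2 * r * card ?S + 1)" by (rule mult_left_mono) simp
  then have "4 * 4 ^ r \<le> 8 * r * 2 ^ r + card ?S * (8 * r) + 4" by (simp add: algebra_simps)
  moreover have "8 * r * 2 ^ r \<le> 4 ^ r" unfolding four(2) using assms(1) by (rule mult_right_mono) simp
  moreover have "4 \<le> (4::nat) ^ r" using power_increasing[of 1 r "4::nat"] assms(2) by simp
  ultimately show ?thesis by linarith
qed

section \<open>Rational roots and integer polynomials from integral elements\<close>

lemma clear_denominators:
  fixes A :: "'a :: field_char_0 set"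
  assumes "finite A" "A \<subseteq> \<rat>"
  obtains c :: int where "c > 0" "\<And>r. r \<in> A \<Longrightarrow> of_int c * r \<in> \<int>"
proof -
  have "\<exists>c::int. c > 0 \<and> (\<forall>r\<in>A. of_int c * r \<in> \<int>)"
    using assms
  proof (induction rule: finite_induct)
    case (insert r A)
    then obtain c :: int where c: "c > 0" "\<forall>r\<in>A. of_int c * r \<in> \<int>" by blast
    from insert.prems have "r \<in> \<rat>" by simp
    then obtain a b :: int where b: "b > 0" "r = of_int a / of_int b" by (rule Rats_cases') blast
    have "of_int (c * b) * r = of_int (c * a)" using b by simp
    then have "of_int (c * b) * r \<in> \<int>" by (metis Ints_of_int)
    moreover have "of_int (c * b) * s \<in> \<int>" if "s \<in> A" for s
      using Ints_mult[OF Ints_of_int[of b] c(2)[rule_format, OF that]] by (simp add: ac_simps)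
    ultimately have "\<forall>s\<in>insert r A. of_int (c * b) * s \<in> \<int>" by simp
    then show ?case using b(1) c(1) by (intro exI[of _ "c * b"]) simp
  qed (intro exI[of _ 1], simp)
  then show ?thesis using that by blast
qed

lemma of_int_poly_degree: "Polynomial.degree (map_poly real_of_int F) = Polynomial.degree F"
  by (rule degree_map_poly) simp

lemma poly_map_real_of_int: "poly (map_poly real_of_int F) (of_int z) = of_int (poly F z)"
  by (induction F) (simp_all add: map_poly_pCons)

text \<open>
  If \<open>n - (a / k) p\<close> is a root, multiplying by a common denominator \<open>B\<close> of the rational roots shows that
  \<open>k\<close> divides \<open>B a p\<close>, hence \<open>B a\<close>, as \<open>k < p\<close>. So \<open>a / k \<ge> 1 / B\<close>, and the root being
  bounded from below makes \<open>p\<close> at most proportional to \<open>n\<close>.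
\<close>
lemma rational_root_bound:
  fixes F :: "int poly"
  assumes "F \<noteq> 0"
  obtains B R :: nat where
    "\<And>p n a k :: nat. Factorial_Ring.prime p \<Longrightarrow> 1 \<le> a \<Longrightarrow> 1 \<le> k \<Longrightarrow> k < p \<Longrightarrow>
      poly (map_poly real_of_int F) (real n - real a / real k * real p) = 0 \<Longrightarrow> p \<le> B * (n + R)"
proof -
  let ?F = "map_poly real_of_int F"
  have F0: "?F \<noteq> 0" using assms by (simp add: map_poly_eq_0_iff)
  define Z where "Z = {z. poly ?F z = 0}"
  have fin: "finite Z" unfolding Z_def using F0 by (rule poly_roots_finite)
  obtain B :: int where B: "B > 0" "\<And>z. z \<in> Z \<inter> \<rat> \<Longrightarrow> of_int B * z \<in> \<int>"
    using clear_denominators[of "Z \<inter> \<rat>"] fin by blast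
  obtain R0 where R0: "\<And>z. z \<in> Z \<Longrightarrow> \<bar>z\<bar> \<le> R0"
  proof
    fix z assume "z \<in> Z"
    then show "\<bar>z\<bar> \<le> Max (abs ` Z)" using fin by (intro Max_ge) auto
  qed
  define R where "R = nat \<lceil>R0\<rceil>"
  have R: "\<bar>z\<bar> \<le> real R" if "z \<in> Z" for z
    using R0[OF that] unfolding R_def by linarith
  show ?thesis
  proof (rule that[of "nat B" R])
    fix p n a k :: nat
    assume p: "Factorial_Ring.prime p" and ak: "1 \<le> a" "1 \<le> k" "k < p"
      and root: "poly ?F (real n - real a / real k * real p) = 0"
    let ?z = "real n - real a / real k * real p"
    have z: "?z \<in> Z" using root by (simp add: Z_def)
    have "?z \<in> \<rat>" by (intro Rats_diff Rats_mult Rats_divide Rats_of_nat)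
    then have "of_int B * real n - of_int B * ?z \<in> \<int>" using B(2) z by (intro Ints_diff) auto
    then obtain m where m: "of_int B * real n - of_int B * ?z = of_int m" by (elim Ints_cases)
    have "real_of_int B * real a * real p = real_of_int m * real k"
      using m ak by (simp add: field_simps)
    then have "real_of_int (B * int a * int p) = real_of_int (m * int k)" by simp
    then have "B * int a * int p = m * int k" by (simp only: of_int_eq_iff)
    then have "int k dvd B * int a * int p" by simp
    moreover have "coprime k p"
      using p ak by (metis coprime_commute nat_dvd_not_less not_less_eq_eq One_nat_def le_0_eq not_less0 prime_imp_coprime zero_less_iff_neq_zero)
    ultimately have "int k dvd B * int a" by (simp add: coprime_dvd_mult_left_iff)
    then have "int k \<le> B * int a" using B(1) ak by (intro zdvd_imp_le) auto
    then have kB: "real k \<le> real_of_int B * real a" by (metis of_int_le_iff of_int_mult of_int_of_nat_eq)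
    have "real a / real k * real p \<le> real n + real R" using R[OF z] by linarith
    then have "real a * real p \<le> real k * (real n + real R)" using ak by (simp add: field_simps)
    also have "\<dots> \<le> real_of_int B * real a * (real n + real R)" using kB by (rule mult_right_mono) simp
    finally have "real a * real p \<le> real a * (real_of_int B * (real n + real R))" by (simp add: algebra_simps)
    then have "real p \<le> real_of_int B * (real n + real R)" using ak by simp
    then have "real p \<le> real (nat B * (n + R))" using B(1) by simp
    then show "p \<le> nat B * (n + R)" by (simp only: of_nat_le_iff)
  qed
qed

lemma class_A_pow: "class_A a [^]\<^bsub>ring_A\<^esub> (n::nat) = class_A (\<lambda>p. a p ^ n)"
proof -
  interpret R: cring ring_A by (rule ring_A_cring)
  show ?thesis by (induction n) (simp_all add: class_A_one class_A_mult mult.commute)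
qed

lemma class_A_zero: "class_A (\<lambda>p. 0) = \<zero>\<^bsub>ring_A\<^esub>"
proof -
  interpret R: cring ring_A by (rule ring_A_cring)
  have "class_A (\<lambda>p. 0) \<oplus>\<^bsub>ring_A\<^esub> class_A (\<lambda>p. 0) = class_A (\<lambda>p. 0)" by (simp add: class_A_add)
  then show ?thesis using class_A_closed R.add.l_cancel_one by blast
qed

lemma rat_A_closed: "rat_A r \<in> carrier ring_A"
  by (simp add: rat_A_def class_A_closed split: prod.split)

lemma rat_A_of_int: "rat_A (of_int z) = class_A (\<lambda>p. z)"
proof -
  have c: "[z * modular_inverse (int p) 1 = z] (mod int p)" for p
    using cong_scalar_left[OF cong_modular_inverse1[of 1 "int p"], of z] by simp
  have "rat_A (of_int z) = class_A (\<lambda>p. z * modular_inverse (int p) 1)"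
    using rat_A_fraction[of 1 z] by (simp only: of_int_1 div_by_1)
  also have "\<dots> = class_A (\<lambda>p. z)"
    unfolding class_A_eq_iff using c by (simp only: not_True_eq_False) simp
  finally show ?thesis .
qed

lemma eval_map_of_int:
  "ring.eval ring_A (map (\<lambda>z. rat_A (of_int z)) zs) (class_A a) = class_A (\<lambda>p. poly (Poly (rev zs)) (a p))"
proof -
  interpret R: cring ring_A by (rule ring_A_cring)
  show ?thesis
  proof (induction zs)
    case Nil
    then show ?case by (simp add: class_A_zero)
  next
    case (Cons z zs)
    then show ?case
      by (simp add: rat_A_of_int class_A_pow class_A_mult class_A_add Poly_snoc poly_monom add.commute)
  qed
qed

lemma eval_scale:
  assumes "x \<in> carrier ring_A"
  shows "rat_A c \<otimes>\<^bsub>ring_A\<^esub> ring.eval ring_A (map rat_A rs) x = ring.eval ring_A (map (\<lambda>r. rat_A (c * r)) rs) x"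
proof -
  interpret R: cring ring_A by (rule ring_A_cring)
  have closed: "R.eval (map rat_A rs) x \<in> carrier ring_A" for rs
    using assms rat_A_closed by (intro R.eval_in_carrier) auto
  show ?thesis
  proof (induction rs)
    case Nil
    then show ?case by (simp add: rat_A_closed)
  next
    case (Cons r rs)
    then show ?case
      using assms closed[of rs] by (simp add: rat_A_mult rat_A_closed R.r_distr R.m_assoc)
  qed
qed

text \<open>
  Multiply the monic equation by a common denominator of its coefficients. The resulting leading coefficient is
  that denominator, which is why the polynomial is not zero.
\<close>
lemma integral_imp_integer_polynomial:
  assumes "class_A a \<in> C_A"
  obtains F :: "int poly" where "F \<noteq> 0" "finite {p \<in> primes. \<not> int p dvd poly F (a p)}"
proof -
  interpret R: cring ring_A by (rule ring_A_cring)
  obtain f where f: "f \<in> carrier (univ_poly ring_A (range rat_A))" "f \<noteq> []" "hd f = \<one>\<^bsub>ring_A\<^esub>"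
    "R.eval f (class_A a) = \<zero>\<^bsub>ring_A\<^esub>"
    using assms by (auto simp: C_A_def integral_closure_def)
  have "set f \<subseteq> range rat_A" using f(1) by (auto simp: univ_poly_def polynomial_def)
  then obtain rs where rs: "f = map rat_A rs" by (metis ex_map_conv subsetD rangeE)
  have "rs \<noteq> []" using f(2) rs by simp
  have "rat_A (hd rs) = rat_A 1" using f(2,3) rs by (simp add: hd_map rat_A_one)
  then have hd: "hd rs = 1" using rat_A_inj by (simp add: inj_eq)
  have rat: "set rs \<subseteq> \<rat>"
  proof
    fix r
    obtain u v where "quotient_of r = (u, v)" by fastforce
    then have "r = of_int u / of_int v" by (rule quotient_of_div)
    then show "r \<in> \<rat>" by simp
  qed
  obtain c :: int where c: "c > 0" "\<And>r. r \<in> set rs \<Longrightarrow> of_int c * r \<in> \<int>"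
    using clear_denominators[of "set rs"] rat by blast
  define zs where "zs = map (\<lambda>r. \<lfloor>of_int c * r\<rfloor>) rs"
  have zs: "map (\<lambda>z. rat_A (of_int z)) zs = map (\<lambda>r. rat_A (of_int c * r)) rs"
    using c(2) by (simp add: zs_def of_int_floor)
  let ?F = "Poly (rev zs)"
  have "class_A (\<lambda>p. poly ?F (a p)) = R.eval (map (\<lambda>z. rat_A (of_int z)) zs) (class_A a)"
    by (rule eval_map_of_int[symmetric])
  also have "\<dots> = rat_A (of_int c) \<otimes>\<^bsub>ring_A\<^esub> R.eval f (class_A a)"
    unfolding zs rs by (rule eval_scale[symmetric]) (rule class_A_closed)
  also have "\<dots> = class_A (\<lambda>p. 0)"
    unfolding f(4) class_A_zero by (rule R.r_null) (rule rat_A_closed)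
  finally have "finite {p \<in> primes. \<not> int p dvd poly ?F (a p)}"
    by (simp add: class_A_eq_iff cong_0_iff)
  moreover have "?F \<noteq> 0"
  proof
    assume "?F = 0"
    have "zs \<noteq> []" "hd zs = c" using \<open>rs \<noteq> []\<close> hd by (simp_all add: zs_def hd_map)
    then have "Polynomial.coeff ?F (length zs - 1) = c" using last_coeff_is_hd[of "rev zs"] by simp
    then show False using c(1) \<open>?F = 0\<close> by simp
  qed
  ultimately show ?thesis using that by blast
qed

section \<open>Transcendence of the prime counting element\<close>

lemma polynomial_less_exp: "eventually (\<lambda>r::nat. A * (8 * real r) ^ e < 2 ^ r) at_top"
  by real_asymp

theorem corollary1p4:
  shows "pi_A \<notin> C_A"
proof
  assume "pi_A \<in> C_A"
  then obtain F :: "int poly" where F: "F \<noteq> 0"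
    and fin: "finite {p \<in> primes. \<not> int p dvd poly F (int (prime_counting p))}"
    unfolding pi_A_def by (rule integral_imp_integer_polynomial)
  let ?F = "map_poly real_of_int F"
  define d where "d = Polynomial.degree F"
  have dF: "Polynomial.degree ?F = d" by (simp add: d_def of_int_poly_degree)
  obtain P where P: "\<And>p. p \<in> primes \<Longrightarrow> P < p \<Longrightarrow> int p dvd poly F (int (prime_counting p))"
    using finite_nat_set_iff_bounded_le fin by (metis (mono_tags, lifting) mem_Collect_eq not_le)
  obtain A where A: "A \<ge> 1" "\<And>x T. T \<ge> 1 \<Longrightarrow> \<bar>x\<bar> \<le> T \<Longrightarrow> \<bar>poly ?F x\<bar> \<le> A * T ^ d"
    using poly_growth_bound[of ?F] unfolding dF by blast
  obtain B R :: nat where BR: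
    "\<And>p n a k :: nat. Factorial_Ring.prime p \<Longrightarrow> 1 \<le> a \<Longrightarrow> 1 \<le> k \<Longrightarrow> k < p \<Longrightarrow>
      poly ?F (real n - real a / real k * real p) = 0 \<Longrightarrow> p \<le> B * (n + R)"
    using rational_root_bound[OF F] by blast
  obtain N where N: "\<And>n. 2 * B * prime_counting n \<le> n + N" using prime_counting_sublinear[of "2 * B"] by blast
  \<comment> \<open>With \<open>K = (8 r)\<close> to the power \<open>4 ^ (2 d)\<close>, the size condition on \<open>p\<close> becomes \<open>C (8 r)\<^sup>e < 2\<^sup>r\<close>; the factor 4 in \<open>C\<close> also covers \<open>4 K < 2\<^sup>r\<close>.\<close>
  define e where "e = 4 ^ (2 * d) * (2 * d + 1)"
  define C where "C = 4 * (2 ^ d * A * (real d + 1) ^ (d + 1) * 2 ^ d)"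
  have "eventually (\<lambda>r::nat. C * (8 * real r) ^ e < 2 ^ r) at_top" by (rule polynomial_less_exp)
  moreover have "eventually (\<lambda>r::nat. real (P + N + 2 * B * R) < 2 ^ r) at_top" by real_asymp
  moreover have "eventually (\<lambda>r::nat. r \<ge> 8) at_top" by (rule eventually_ge_at_top)
  ultimately have "eventually (\<lambda>r::nat. C * (8 * real r) ^ e < 2 ^ r \<and>
      real (P + N + 2 * B * R) < 2 ^ r \<and> r \<ge> 8) at_top"
    by (intro eventually_conj)
  then obtain r :: nat where r: "C * (8 * real r) ^ e < 2 ^ r" "real (P + N + 2 * B * R) < 2 ^ r" "r \<ge> 8"
    using eventually_happens by fastforce
  define L where "L = 8 * r"
  define K where "K = L ^ (4 ^ (2 * d))"
  have L: "L \<ge> 64" using r(3) by (simp add: L_def)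
  have K1: "K \<ge> 1" using L by (simp add: K_def)
  have Ke: "real K ^ (2 * d + 1) = (8 * real r) ^ e"
    by (simp only: K_def L_def e_def power_mult of_nat_power of_nat_mult of_nat_numeral)
  have C4: "C \<ge> 4"
  proof -
    have "1 * 1 * 1 * 1 \<le> 2 ^ d * A * (real d + 1) ^ (d + 1) * 2 ^ d"
      using A(1) by (intro mult_mono one_le_power) auto
    then show ?thesis by (simp add: C_def)
  qed
  have KC: "4 * real K < 2 ^ r"
  proof -
    have "4 * real K ^ 1 \<le> C * real K ^ (2 * d + 1)"
      using C4 K1 by (intro mult_mono power_increasing) auto
    then show ?thesis using r(1) Ke by simp
  qed
  then have K4: "4 * K < 2 ^ r" by (metis of_nat_less_iff of_nat_mult of_nat_numeral of_nat_power)
  have LK: "L \<le> K" unfolding K_def using L power_increasing[of 1 "4 ^ (2 * d)" L] by simp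
  \<comment> \<open>Small primes are left out so that every ordinate of a cube exceeds the square root of \<open>4\<^sup>r\<close>.\<close>
  define S where "S = {p \<in> primes. 2 ^ r < p \<and> p \<le> (4::nat) ^ r}"
  have dense: "4 ^ r \<le> card S * L"
    unfolding S_def L_def using many_primes[of r] LK K4 r(3) by (simp add: L_def)
  have "(2::nat) ^ r \<le> 4 ^ r" by (rule power_mono) auto
  then have room: "4 * L ^ 4 ^ (2 * d) \<le> 4 ^ r" using K4 by (simp add: K_def)
  have sub: "S \<subseteq> {..4 ^ r}" by (auto simp: S_def)
  have strict: "strict_mono_on S prime_counting"
    using prime_counting_strict_mono by (auto simp: strict_mono_on_def S_def)
  have lip: "\<forall>s k. prime_counting (s + k) \<le> prime_counting s + k" using prime_counting_add_le by blast
  obtain vs p where vs: "length vs = 2 * d" "p \<in> S" "\<forall>v\<in>set vs. step_le K v"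
    "cube (\<lambda>x y. \<exists>t\<in>S. x = real (prime_counting t) \<and> y = real t) vs (real (prime_counting p)) (real p)"
    using dense_graph_contains_cube[OF sub dense L room strict lip] unfolding K_def by (elim exE conjE)
  have p: "Factorial_Ring.prime p" "2 ^ r < p" using vs(2) by (auto simp: S_def)
  have big: "2 ^ r < real p" using p(2) by (metis of_nat_less_iff of_nat_numeral of_nat_power)
  have pbig: "P + N + 2 * B * R < p" "K < p"
  proof -
    have "real (P + N + 2 * B * R) < real p" using r(2) big by linarith
    then show "P + N + 2 * B * R < p" by (simp only: of_nat_less_iff)
    show "K < p" using K4 p(2) by linarith
  qed
  have ints: "cube (\<lambda>x y. poly ?F x / y \<in> \<int>) vs (real (prime_counting p)) (real p)"
    using vs(4)
  proof (rule cube_mono)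
    fix x y :: real assume "\<exists>t\<in>S. x = real (prime_counting t) \<and> y = real t"
    then obtain t where t: "t \<in> S" "x = real (prime_counting t)" "y = real t" by blast
    have "2 ^ r < real t" using t(1) by (auto simp: S_def)
    moreover have "real P \<le> real (P + N + 2 * B * R)" by (simp only: of_nat_le_iff add.assoc le_add1)
    ultimately have "real P < real t" using r(2) by linarith
    then have "int t dvd poly F (int (prime_counting t))" using t(1) P[of t] by (simp add: S_def)
    then obtain m where m: "poly F (int (prime_counting t)) = int t * m" by (elim dvdE)
    have "poly ?F x = real_of_int (poly F (int (prime_counting t)))"
      using poly_map_real_of_int[of F "int (prime_counting t)"] by (simp add: t(2))
    then have "poly ?F x / y = real_of_int m" using m t(3) \<open>real P < real t\<close> by simp
    then show "poly ?F x / y \<in> \<int>" by simp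
  qed
  have "\<not> cube (\<lambda>x y. poly ?F x / y \<in> \<int>) vs (real (prime_counting p)) (real p)"
  proof (rule no_integral_cube[of _ A _ K])
    show "1 \<le> \<bar>Polynomial.lead_coeff ?F\<bar>"
    proof -
      have "Polynomial.lead_coeff F \<noteq> 0" using F by simp
      then have "1 \<le> \<bar>real_of_int (Polynomial.lead_coeff F)\<bar>" by linarith
      then show ?thesis by (simp add: of_int_poly_degree coeff_map_poly)
    qed
    show "1 \<le> A" by (rule A(1))
    show "\<bar>poly ?F x\<bar> \<le> A * T ^ Polynomial.degree ?F" if "1 \<le> T" "\<bar>x\<bar> \<le> T" for x T
      using A(2) that by (simp add: dF)
    show "length vs = 2 * Polynomial.degree ?F" using vs(1) by (simp add: dF)
    show "step_le K v" if "v \<in> set vs" for v using vs(3) that by blast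
    show "1 \<le> K" by (rule K1)
    show "0 \<le> real (prime_counting p)" by simp
    show "real (prime_counting p) \<le> real p" using prime_counting_le by simp
    show "2 ^ Polynomial.degree ?F * (A * (real (Polynomial.degree ?F) * real K + 1) ^ (Polynomial.degree ?F + 1)) *
        (2 * real K) ^ Polynomial.degree ?F < real p"
      unfolding dF
    proof -
      have "real d * real K + 1 \<le> (real d + 1) * real K" using K1 by (simp add: algebra_simps)
      then have "(real d * real K + 1) ^ (d + 1) \<le> ((real d + 1) * real K) ^ (d + 1)"
        by (rule power_mono) simp
      then have "2 ^ d * (A * (real d * real K + 1) ^ (d + 1)) * (2 * real K) ^ d \<le>
          2 ^ d * (A * ((real d + 1) * real K) ^ (d + 1)) * (2 * real K) ^ d"
        using A(1) by (intro mult_right_mono mult_left_mono) auto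
      also have "\<dots> = C / 4 * real K ^ (2 * d + 1)"
      proof -
        have K': "real K ^ (2 * d + 1) = real K ^ (d + 1) * real K ^ d"
          by (simp add: power_add[symmetric] mult_2)
        have C': "C / 4 = 2 ^ d * A * (real d + 1) ^ (d + 1) * 2 ^ d" by (simp add: C_def)
        show ?thesis unfolding K' C' power_mult_distrib by (simp only: ac_simps)
      qed
      also have "\<dots> \<le> C * real K ^ (2 * d + 1)" using C4 by (intro mult_right_mono) auto
      also have "\<dots> < real p" unfolding Ke using r(1) big by (rule less_trans)
      finally show "2 ^ d * (A * (real d * real K + 1) ^ (d + 1)) * (2 * real K) ^ d < real p" .
    qed
    fix a k :: nat assume ak: "1 \<le> a" "1 \<le> k" "k \<le> K"
    show "poly ?F (real (prime_counting p) - real a / real k * real p) \<noteq> 0"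
    proof
      assume "poly ?F (real (prime_counting p) - real a / real k * real p) = 0"
      then have "p \<le> B * (prime_counting p + R)" using BR[of p a k] p(1) ak pbig(2) by simp
      then have "2 * p \<le> 2 * B * prime_counting p + 2 * B * R" by (simp add: algebra_simps)
      then show False using N[of p] pbig(1) by linarith
    qed
  qed
  with ints show False by blast
qed

end
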